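(* Let $q\ge2$, $n\ge 2$, and let $C$ be a tight $4$-design in $H(n,q)$, with degree set $\{\alpha_1,\alpha_2\}$, $\alpha_1<\alpha_2$. For $1\le i\le q$ let $C_i=\{(x_2,\ldots,x_n):(i,x_2,\ldots,x_n)\in C\}$ and $\tilde C=\bigcup_{i=1}^q C_i\subseteq V^{n-1}$. Define $\tilde S_0=\{(x,y)\in\tilde C\times\tilde C: d(x,y)=0\}$ and, for $i\in\{1,2\}$, $\tilde S_{2i-1}=\{(x,y)\in\tilde C\times\tilde C: d(x,y)=\alpha_i-1\}$, $\tilde S_{2i}=\{(x,y)\in\tilde C\times\tilde C: d(x,y)=\alpha_i\}$. Then $(\tilde C,\{\tilde S_i\}_{i=0}^4)$ is a $Q$-antipodal $Q$-polynomial association scheme of $4$ classes with Krein array $\{(n-1)(q-1),(n-2)(q-1),2(q-1),1;\ 1,2,(n-2)(q-1),(n-1)(q-1)\}$.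
   Context: $V=\{1,\ldots,q\}$, $d$ is the Hamming distance. $H(n,q)$ is the Hamming association scheme on $V^n$. A subset $C\subseteq V^n$ is a $4$-design in $H(n,q)$ iff it is an orthogonal array of strength $4$ (for every $4$ coordinates, each vector of $V^4$ occurs equally often among the restrictions of elements of $C$); it is tight if $|C|=1+n(q-1)+\binom n2(q-1)^2$. The degree set of $C$ is the set of distances $d(x,y)$, $x\ne y\in C$. An association scheme $(X,\{R_i\}_{i=0}^D)$: adjacency matrices $A_i$ with $A_0=I$, $\sum A_i=J$, $A_i^\top=A_i$, $A_iA_j=\sum_k p_{ij}^kA_k$ with nonnegative integers $p_{ij}^k$; primitive idempotents $E_0=\frac1{|X|}J,E_1,\dots,E_D$ of the algebra spanned by the $A_i$. Krein parameters $q_{ij}^k$ are defined by $E_i\circ E_j=\frac1{|X|}\sum_k q_{ij}^kE_k$ ($\circ$ entrywise product). The scheme is $Q$-polynomial (w.r.t. an ordering $E_0,\dots,E_D$) iff the matrix $(q_{1j}^k)_{k,j}$ is tridiagonal with nonzero sub- and superdiagonal entries; then with $b_i^*=q_{1,i+1}^i$, $c_i^*=q_{1,i-1}^i$ its Krein array is $\{b_0^*,\ldots,b_{D-1}^*;c_1^*,\ldots,c_D^*\}$. A $Q$-polynomial scheme is $Q$-antipodal if $b_i^*=c_{D-i}^*$ for all $i$ except possibly $i=\lfloor D/2\rfloor$.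
   Formalization: A 4-design in H(n,q) is taken to require n ≥ 4, although the statement says n ≥ 2; for n = 2 the condition would be vacuous and C = V² a counterexample (S̃_0 = S̃_1), and for n = 3 no such C exists. *)

theory Defs
  imports Complex_Main
begin

section \<open>Words, Hamming distance, designs in the Hamming scheme\<close>

text \<open>
  The set \<open>V\<^sup>n\<close> with \<open>V = {1, \<dots>, q}\<close> is the set of lists of length \<open>n\<close> with entries in \<open>V\<close>.
  The coordinates \<open>1, \<dots>, n\<close> of the mathematics are the list positions \<open>0, \<dots>, n - 1\<close>.
\<close>

definition words :: "nat \<Rightarrow> nat \<Rightarrow> nat list set" where
  "words n q = {x. length x = n \<and> set x \<subseteq> {1..q}}"

text \<open>Only meaningful for two lists of the same length.\<close>

definition hamming_dist :: "'a list \<Rightarrow> 'a list \<Rightarrow> nat" where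
  "hamming_dist x y = card {k. k < length x \<and> x ! k \<noteq> y ! k}"

definition degree_set :: "'a list set \<Rightarrow> nat set" where
  "degree_set C = {hamming_dist x y |x y. x \<in> C \<and> y \<in> C \<and> x \<noteq> y}"

text \<open>
  The term \<open>nths x T\<close> is the restriction of \<open>x\<close> to the coordinates in \<open>T\<close>. As usual for
  orthogonal arrays (and for designs in a \<open>Q\<close>-polynomial scheme with \<open>n\<close> classes), strength \<open>t\<close>
  presupposes \<open>t \<le> n\<close>; without it the condition would be vacuous for \<open>n < t\<close>.
\<close>

definition hamming_design :: "nat \<Rightarrow> nat \<Rightarrow> nat \<Rightarrow> nat list set \<Rightarrow> bool" where
  "hamming_design t n q C \<longleftrightarrow>
     t \<le> n \<and> C \<subseteq> words n q \<and>
     (\<forall>T. T \<subseteq> {..<n} \<and> card T = t \<longrightarrow>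
        (\<exists>m. \<forall>v \<in> words t q. card {x \<in> C. nths x T = v} = m))"

definition tight_4_design :: "nat \<Rightarrow> nat \<Rightarrow> nat list set \<Rightarrow> bool" where
  "tight_4_design n q C \<longleftrightarrow>
     hamming_design 4 n q C \<and>
     card C = 1 + n * (q - 1) + (n choose 2) * (q - 1)\<^sup>2"

definition derived_code :: "nat list set \<Rightarrow> nat \<Rightarrow> nat list set" where
  "derived_code C i = {x. i # x \<in> C}"

definition tilde_code :: "nat \<Rightarrow> nat list set \<Rightarrow> nat list set" where
  "tilde_code q C = (\<Union>i \<in> {1..q}. derived_code C i)"

text \<open>Only the indices \<open>k \<le> 4\<close> are meaningful.\<close>

definition tilde_rel ::
  "nat \<Rightarrow> nat list set \<Rightarrow> nat \<Rightarrow> nat \<Rightarrow> nat \<Rightarrow> (nat list \<times> nat list) set" where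
  "tilde_rel q C \<alpha>1 \<alpha>2 k =
     {(x, y) \<in> tilde_code q C \<times> tilde_code q C.
        hamming_dist x y = [0, \<alpha>1 - 1, \<alpha>1, \<alpha>2 - 1, \<alpha>2] ! k}"


section \<open>Symmetric association schemes\<close>

text \<open>
  Real matrices with rows and columns indexed by a finite set \<open>X\<close> are functions of two arguments
  that vanish outside \<open>X \<times> X\<close>, so that equality of matrices is equality of functions.
\<close>

type_synonym 'a mtx = "'a \<Rightarrow> 'a \<Rightarrow> real"

definition mtx_mult :: "'a set \<Rightarrow> 'a mtx \<Rightarrow> 'a mtx \<Rightarrow> 'a mtx" where
  "mtx_mult X A B = (\<lambda>x y. \<Sum>z\<in>X. A x z * B z y)"

definition mtx_zero :: "'a mtx" where
  "mtx_zero = (\<lambda>x y. 0)"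

definition mtx_one :: "'a set \<Rightarrow> 'a mtx" where
  "mtx_one X = (\<lambda>x y. of_bool (x \<in> X \<and> y = x))"

definition mtx_all_ones :: "'a set \<Rightarrow> 'a mtx" where
  "mtx_all_ones X = (\<lambda>x y. of_bool (x \<in> X \<and> y \<in> X))"

definition adjacency :: "('a \<times> 'a) set \<Rightarrow> 'a mtx" where
  "adjacency R = (\<lambda>x y. of_bool ((x, y) \<in> R))"

definition association_scheme :: "'a set \<Rightarrow> nat \<Rightarrow> (nat \<Rightarrow> ('a \<times> 'a) set) \<Rightarrow> bool" where
  "association_scheme X D R \<longleftrightarrow>
     finite X \<and> X \<noteq> {} \<and>
     (\<forall>i\<le>D. R i \<noteq> {} \<and> R i \<subseteq> X \<times> X) \<and>
     adjacency (R 0) = mtx_one X \<and>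
     (\<lambda>x y. \<Sum>i\<le>D. adjacency (R i) x y) = mtx_all_ones X \<and>
     (\<forall>i\<le>D. (\<lambda>x y. adjacency (R i) y x) = adjacency (R i)) \<and>
     (\<exists>p :: nat \<Rightarrow> nat \<Rightarrow> nat \<Rightarrow> nat. \<forall>i\<le>D. \<forall>j\<le>D.
        mtx_mult X (adjacency (R i)) (adjacency (R j)) =
          (\<lambda>x y. \<Sum>k\<le>D. real (p i j k) * adjacency (R k) x y))"

definition adjacency_algebra :: "nat \<Rightarrow> (nat \<Rightarrow> ('a \<times> 'a) set) \<Rightarrow> 'a mtx set" where
  "adjacency_algebra D R = {\<lambda>x y. \<Sum>i\<le>D. c i * adjacency (R i) x y |c. True}"

definition idempotents :: "'a set \<Rightarrow> 'a mtx set \<Rightarrow> 'a mtx set" where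
  "idempotents X \<A> = {E \<in> \<A>. mtx_mult X E E = E}"

definition primitive_idempotents :: "'a set \<Rightarrow> 'a mtx set \<Rightarrow> 'a mtx set" where
  "primitive_idempotents X \<A> =
     {E \<in> idempotents X \<A>. E \<noteq> mtx_zero \<and>
        \<not> (\<exists>F \<in> idempotents X \<A>. \<exists>G \<in> idempotents X \<A>.
              F \<noteq> mtx_zero \<and> G \<noteq> mtx_zero \<and>
              mtx_mult X F G = mtx_zero \<and> mtx_mult X G F = mtx_zero \<and>
              E = (\<lambda>x y. F x y + G x y))}"

definition idempotent_ordering ::
  "'a set \<Rightarrow> nat \<Rightarrow> (nat \<Rightarrow> ('a \<times> 'a) set) \<Rightarrow> (nat \<Rightarrow> 'a mtx) \<Rightarrow> bool" where
  "idempotent_ordering X D R E \<longleftrightarrow>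
     bij_betw E {..D} (primitive_idempotents X (adjacency_algebra D R)) \<and>
     E 0 = (\<lambda>x y. mtx_all_ones X x y / real (card X))"

text \<open>
  The term \<open>krein X D E i j k\<close> is the Krein parameter \<open>q\<^sub>i\<^sub>j\<^sup>k\<close>. The coefficients with index up to
  \<open>D\<close> are determined because the primitive idempotents are linearly independent; those beyond \<open>D\<close>
  are set to \<open>0\<close> to make the coefficient function unique.
\<close>

definition krein :: "'a set \<Rightarrow> nat \<Rightarrow> (nat \<Rightarrow> 'a mtx) \<Rightarrow> nat \<Rightarrow> nat \<Rightarrow> nat \<Rightarrow> real" where
  "krein X D E i j =
     (THE c. (\<forall>k>D. c k = 0) \<and>
        (\<lambda>x y. E i x y * E j x y) =
          (\<lambda>x y. 1 / real (card X) * (\<Sum>k\<le>D. c k * E k x y)))"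

definition Q_polynomial ::
  "'a set \<Rightarrow> nat \<Rightarrow> (nat \<Rightarrow> ('a \<times> 'a) set) \<Rightarrow> (nat \<Rightarrow> 'a mtx) \<Rightarrow> bool" where
  "Q_polynomial X D R E \<longleftrightarrow>
     association_scheme X D R \<and> 1 \<le> D \<and> idempotent_ordering X D R E \<and>
     (\<forall>j\<le>D. \<forall>k\<le>D.
        (k + 1 < j \<or> j + 1 < k \<longrightarrow> krein X D E 1 j k = 0) \<and>
        (j = k + 1 \<or> k = j + 1 \<longrightarrow> krein X D E 1 j k \<noteq> 0))"

definition krein_b :: "'a set \<Rightarrow> nat \<Rightarrow> (nat \<Rightarrow> 'a mtx) \<Rightarrow> nat \<Rightarrow> real" where
  "krein_b X D E i = krein X D E 1 (i + 1) i"

definition krein_c :: "'a set \<Rightarrow> nat \<Rightarrow> (nat \<Rightarrow> 'a mtx) \<Rightarrow> nat \<Rightarrow> real" where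
  "krein_c X D E i = krein X D E 1 (i - 1) i"

definition krein_array :: "'a set \<Rightarrow> nat \<Rightarrow> (nat \<Rightarrow> 'a mtx) \<Rightarrow> real list \<times> real list" where
  "krein_array X D E = (map (krein_b X D E) [0..<D], map (krein_c X D E) [1..<D + 1])"

definition Q_antipodal ::
  "'a set \<Rightarrow> nat \<Rightarrow> (nat \<Rightarrow> ('a \<times> 'a) set) \<Rightarrow> (nat \<Rightarrow> 'a mtx) \<Rightarrow> bool" where
  "Q_antipodal X D R E \<longleftrightarrow>
     Q_polynomial X D R E \<and>
     (\<forall>i<D. i \<noteq> D div 2 \<longrightarrow> krein_b X D E i = krein_c X D E (D - i))"

end

theory Submission
  imports Defs "HOL-Library.FuncSet"
begin

text \<open>
  For a set \<open>T\<close> of coordinates let \<open>\<chi>\<^sub>T(x, y)\<close> be the product of \<open>q [x\<^sub>k = y\<^sub>k] - 1\<close> over \<open>k \<in> T\<close>.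
  Strength \<open>4\<close> makes the matrices \<open>\<chi>\<^sub>T / |C|\<close> with \<open>|T| \<le> 2\<close> pairwise orthogonal idempotents on \<open>C\<close>, and
  tightness makes their traces add up to \<open>|C|\<close>, so that they sum to the identity. Off the diagonal
  this is a quadratic equation for the distances of \<open>C\<close>; it gives \<open>\<alpha>\<^sub>1 \<ge> 2\<close> and \<open>\<alpha>\<^sub>2 \<ge> \<alpha>\<^sub>1 + 2\<close>, hence
  deleting the first coordinate is injective on \<open>C\<close> and the five relations are disjoint. Grouping
  the \<open>\<chi>\<^sub>T\<close> by \<open>|T|\<close> and by whether \<open>T\<close> contains the deleted coordinate yields five idempotents
  which span the same space as the five adjacency matrices. With \<open>e\<close> the sum of the \<open>\<chi>\<^sub>T\<close> over the
  singletons \<open>T\<close> of remaining coordinates and \<open>\<psi>\<close> the \<open>\<chi>\<close> of the deleted one, the Krein parameters are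
  read off from the products of \<open>e\<close> with \<open>1\<close>, \<open>e\<close>, \<open>e\<^sub>2 = (e\<^sup>2 - (q - 2) e - (n - 1) (q - 1)) / 2\<close>, \<open>\<psi> e\<close>
  and \<open>\<psi>\<close>.
\<close>

section \<open>Association schemes from orthogonal idempotents\<close>

locale orthogonal_idempotents =
  fixes X :: "'a set" and D :: nat and E :: "nat \<Rightarrow> 'a mtx"
  assumes orthogonal: "\<And>i j. i \<le> D \<Longrightarrow> j \<le> D \<Longrightarrow>
      mtx_mult X (E i) (E j) = (if i = j then E i else mtx_zero)"
    and nonzero: "\<And>i. i \<le> D \<Longrightarrow> E i \<noteq> mtx_zero"
begin

section \<open>Coordinates in a family of orthogonal idempotents\<close>

definition comb :: "(nat \<Rightarrow> real) \<Rightarrow> 'a mtx" where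
  "comb c = (\<lambda>x y. \<Sum>k\<le>D. c k * E k x y)"

lemma mult_comb: "mtx_mult X (comb c) (comb d) = comb (\<lambda>k. c k * d k)"
proof (intro ext)
  fix x y
  have "mtx_mult X (comb c) (comb d) x y
      = (\<Sum>z\<in>X. \<Sum>i\<le>D. \<Sum>j\<le>D. c i * d j * (E i x z * E j z y))"
    by (simp add: mtx_mult_def comb_def sum_product mult_ac)
  also have "\<dots> = (\<Sum>i\<le>D. \<Sum>z\<in>X. \<Sum>j\<le>D. c i * d j * (E i x z * E j z y))"
    by (rule sum.swap)
  also have "\<dots> = (\<Sum>i\<le>D. \<Sum>j\<le>D. \<Sum>z\<in>X. c i * d j * (E i x z * E j z y))"
    by (intro sum.cong refl sum.swap)
  also have "\<dots> = (\<Sum>i\<le>D. \<Sum>j\<le>D. c i * d j * mtx_mult X (E i) (E j) x y)"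
    by (simp add: mtx_mult_def sum_distrib_left)
  also have "\<dots> = (\<Sum>i\<le>D. \<Sum>j\<le>D. if i = j then c i * d i * E i x y else 0)"
    by (intro sum.cong refl) (auto simp: orthogonal mtx_zero_def)
  also have "\<dots> = comb (\<lambda>k. c k * d k) x y"
    by (simp add: comb_def)
  finally show "mtx_mult X (comb c) (comb d) x y = comb (\<lambda>k. c k * d k) x y" .
qed

lemma comb_unit: "j \<le> D \<Longrightarrow> comb (\<lambda>k. of_bool (k = j)) = E j"
  by (simp add: comb_def of_bool_def if_distrib[of "\<lambda>t. t * _"] cong: if_cong)

text \<open>Multiplication by \<open>E j\<close> kills every term except the one at
  \<open>j\<close>; hence the idempotents are linearly independent.\<close>

lemma comb_eq_zeroD:
  assumes "comb c = mtx_zero" and "j \<le> D"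
  shows "c j = 0"
proof (rule ccontr)
  assume "c j \<noteq> 0"
  have "mtx_mult X (comb c) (comb (\<lambda>k. of_bool (k = j))) = mtx_zero"
    by (simp add: assms mtx_mult_def mtx_zero_def)
  moreover have "(\<lambda>k. c k * of_bool (k = j)) = (\<lambda>k. c j * of_bool (k = j))"
    by auto
  ultimately have "comb (\<lambda>k. c j * of_bool (k = j)) = mtx_zero"
    by (simp only: mult_comb)
  moreover have "comb (\<lambda>k. c j * of_bool (k = j)) = (\<lambda>x y. c j * E j x y)"
    by (subst comb_unit[OF \<open>j \<le> D\<close>, symmetric])
      (simp only: comb_def sum_distrib_left mult.assoc)
  ultimately have "E j = mtx_zero"
    using \<open>c j \<noteq> 0\<close> by (auto simp: mtx_zero_def fun_eq_iff)
  then show False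
    using nonzero \<open>j \<le> D\<close> by blast
qed

lemma comb_eq_iff: "comb c = comb d \<longleftrightarrow> (\<forall>j\<le>D. c j = d j)"
proof
  assume eq: "comb c = comb d"
  have "comb (\<lambda>k. c k - d k) = mtx_zero"
  proof (intro ext)
    fix x y
    have "comb c x y = comb d x y"
      using eq by simp
    then show "comb (\<lambda>k. c k - d k) x y = mtx_zero x y"
      by (simp add: comb_def mtx_zero_def left_diff_distrib sum_subtractf)
  qed
  then show "\<forall>j\<le>D. c j = d j"
    using comb_eq_zeroD by fastforce
qed (simp add: comb_def)

lemma comb_eq_zero_iff: "comb c = mtx_zero \<longleftrightarrow> (\<forall>j\<le>D. c j = 0)"
  using comb_eq_zeroD by (auto simp: comb_def mtx_zero_def)

lemma comb_add: "(\<lambda>x y. comb c x y + comb d x y) = comb (\<lambda>k. c k + d k)"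
  by (simp add: comb_def distrib_right sum.distrib)

lemma idempotent_comb_iff:
  "mtx_mult X (comb c) (comb c) = comb c \<longleftrightarrow> (\<forall>j\<le>D. c j \<in> {0, 1})"
  by (auto simp: mult_comb comb_eq_iff)

text \<open>By \<open>idempotent_comb_iff\<close> the idempotents of the span correspond to subsets
  of \<open>{..D}\<close>, orthogonal sums being disjoint unions; the indecomposable ones are the
  singletons.\<close>

lemma primitive_idempotents_range_comb:
  "primitive_idempotents X (range comb) = E ` {..D}"
proof (intro equalityI subsetI)
  fix F
  assume F: "F \<in> primitive_idempotents X (range comb)"
  then obtain f where f: "F = comb f"
    by (auto simp: primitive_idempotents_def idempotents_def)
  have f01: "f j \<in> {0, 1}" if "j \<le> D" for j
    using F that by (auto simp: primitive_idempotents_def idempotents_def f idempotent_comb_iff)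
  obtain i where i: "i \<le> D" "f i = 1"
    using F f01 by (auto simp: primitive_idempotents_def f comb_eq_zero_iff)
  \<comment> \<open>Dropping the coefficient at \<open>i\<close> splits \<open>F\<close>
    orthogonally into \<open>E i\<close> and \<open>comb g\<close>, so primitivity forces
    \<open>comb g\<close> to vanish.\<close>
  define g :: "nat \<Rightarrow> real" where "g = (\<lambda>k. if k = i then 0 else f k)"
  let ?u = "\<lambda>k. of_bool (k = i) :: real"
  have idem: "comb ?u \<in> idempotents X (range comb)" "comb g \<in> idempotents X (range comb)"
    using f01 by (auto simp: idempotents_def idempotent_comb_iff g_def)
  have sum: "F = (\<lambda>x y. comb ?u x y + comb g x y)"
    using i by (auto simp: f comb_add comb_eq_iff g_def)
  have orth: "mtx_mult X (comb ?u) (comb g) = mtx_zero" "mtx_mult X (comb g) (comb ?u) = mtx_zero"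
    by (auto simp: mult_comb comb_eq_zero_iff g_def)
  have "comb ?u \<noteq> mtx_zero"
    using i by (auto simp: comb_eq_zero_iff)
  then have "comb g = mtx_zero"
    using F idem sum orth unfolding primitive_idempotents_def by blast
  then have "F = comb ?u"
    using sum by (simp add: mtx_zero_def)
  then show "F \<in> E ` {..D}"
    using i comb_unit by auto
next
  fix F
  assume "F \<in> E ` {..D}"
  then obtain i where i: "i \<le> D" "F = comb (\<lambda>k. of_bool (k = i))"
    using comb_unit by auto
  show "F \<in> primitive_idempotents X (range comb)"
    unfolding primitive_idempotents_def
  proof (intro CollectI conjI notI)
    show "F \<in> idempotents X (range comb)"
      by (auto simp: idempotents_def i idempotent_comb_iff)
    show "F = mtx_zero \<Longrightarrow> False"
      using i by (auto simp: comb_eq_zero_iff)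
    assume "\<exists>G\<in>idempotents X (range comb). \<exists>H\<in>idempotents X (range comb).
      G \<noteq> mtx_zero \<and> H \<noteq> mtx_zero \<and> mtx_mult X G H = mtx_zero \<and> mtx_mult X H G = mtx_zero \<and>
      F = (\<lambda>x y. G x y + H x y)"
    then obtain g h where gh: "\<forall>j\<le>D. g j \<in> {0, 1}" "\<forall>j\<le>D. h j \<in> {0, 1}"
      "comb g \<noteq> mtx_zero" "comb h \<noteq> mtx_zero" "F = (\<lambda>x y. comb g x y + comb h x y)"
      by (auto simp: idempotents_def idempotent_comb_iff)
    then have sum: "\<forall>j\<le>D. of_bool (j = i) = g j + h j"
      by (simp add: i comb_add comb_eq_iff)
    \<comment> \<open>The only nonzero coefficient of \<open>F\<close> is the \<open>1\<close> at
      \<open>i\<close>, so both summands have coefficient \<open>1\<close> there, and these would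
      add up to \<open>2\<close>.\<close>
    obtain j k where "j \<le> D" "g j \<noteq> 0" "k \<le> D" "h k \<noteq> 0"
      using gh by (auto simp: comb_eq_zero_iff)
    then have "j = i" "g j = 1" "k = i" "h k = 1"
      using sum gh(1,2) by (force simp: of_bool_def split: if_splits)+
    then show False
      using sum i by auto
  qed
qed

lemma inj_on_E: "inj_on E {..D}"
proof (rule inj_onI)
  fix i j
  assume "i \<in> {..D}" "j \<in> {..D}" "E i = E j"
  then have "comb (\<lambda>k. of_bool (k = i)) = comb (\<lambda>k. of_bool (k = j))"
    by (simp add: comb_unit)
  then show "i = j"
    using \<open>i \<in> {..D}\<close> by (auto simp: comb_eq_iff)
qed

text \<open>Linear independence fixes the coefficients up to \<open>D\<close> and the convention of
  \<open>krein\<close> the others, so any valid expansion is the one described.\<close>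

lemma krein_eqI:
  assumes "card X \<noteq> 0" and "\<And>k. k > D \<Longrightarrow> c k = 0"
    and eq: "\<And>x y. E i x y * E j x y = 1 / real (card X) * (\<Sum>k\<le>D. c k * E k x y)"
  shows "krein X D E i j = c"
  unfolding krein_def
proof (rule the_equality)
  show "(\<forall>k>D. c k = 0) \<and> (\<lambda>x y. E i x y * E j x y) =
      (\<lambda>x y. 1 / real (card X) * (\<Sum>k\<le>D. c k * E k x y))"
    using assms by blast
next
  fix d
  assume d: "(\<forall>k>D. d k = 0) \<and> (\<lambda>x y. E i x y * E j x y) =
      (\<lambda>x y. 1 / real (card X) * (\<Sum>k\<le>D. d k * E k x y))"
  have "comb d x y = comb c x y" for x y
  proof -
    have "1 / real (card X) * (\<Sum>k\<le>D. d k * E k x y) = 1 / real (card X) * (\<Sum>k\<le>D. c k * E k x y)"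
      using conjunct2[OF d, THEN fun_cong, THEN fun_cong, of x y] eq[of x y] by argo
    then show ?thesis
      using \<open>card X \<noteq> 0\<close> by (simp add: comb_def)
  qed
  then have "comb d = comb c"
    by blast
  then have "d k = c k" if "k \<le> D" for k
    using that by (simp add: comb_eq_iff)
  then show "d = c"
    using d assms(2) by (metis ext not_le)
qed

end

section \<open>Schemes whose adjacency algebra is spanned by given idempotents\<close>

locale idempotent_scheme = orthogonal_idempotents X D E
  for X :: "'a set" and D :: nat and E :: "nat \<Rightarrow> 'a mtx" +
  fixes R :: "nat \<Rightarrow> ('a \<times> 'a) set"
  assumes finite: "finite X"
    and nonempty: "X \<noteq> {}"
    and rel_nonempty: "\<And>i. i \<le> D \<Longrightarrow> R i \<noteq> {}"
    and rel_subset: "\<And>i. i \<le> D \<Longrightarrow> R i \<subseteq> X \<times> X"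
    and rel_0: "R 0 = Id_on X"
    and rel_partition: "\<And>x y. x \<in> X \<Longrightarrow> y \<in> X \<Longrightarrow> \<exists>!i. i \<le> D \<and> (x, y) \<in> R i"
    and rel_sym: "\<And>i. i \<le> D \<Longrightarrow> sym (R i)"
    and idempotent_support: "\<And>j x y. j \<le> D \<Longrightarrow> (x, y) \<notin> X \<times> X \<Longrightarrow> E j x y = 0"
    and idempotent_const: "\<And>i j. i \<le> D \<Longrightarrow> j \<le> D \<Longrightarrow> \<exists>v. \<forall>(x, y) \<in> R i. E j x y = v"
    and adjacency_in_range_comb: "\<And>i. i \<le> D \<Longrightarrow> adjacency (R i) \<in> range comb"
begin

lemma rel_disjoint: "i \<le> D \<Longrightarrow> j \<le> D \<Longrightarrow> (x, y) \<in> R i \<Longrightarrow> (x, y) \<in> R j \<Longrightarrow> i = j"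
  using rel_partition rel_subset by blast

lemma sum_adjacency:
  assumes "k \<le> D" and "(x, y) \<in> R k"
  shows "(\<Sum>i\<le>D. c i * adjacency (R i) x y) = c k"
proof -
  have "(\<Sum>i\<le>D. c i * adjacency (R i) x y) = (\<Sum>i\<le>D. if i = k then c i else 0)"
    using assms rel_disjoint by (intro sum.cong refl) (auto simp: adjacency_def)
  then show ?thesis
    using assms by simp
qed

lemma sum_adjacency_outside:
  "(x, y) \<notin> X \<times> X \<Longrightarrow> (\<Sum>i\<le>D. c i * adjacency (R i) x y) = 0"
  using rel_subset by (intro sum.neutral) (auto simp: adjacency_def)

lemma in_adjacency_algebra:
  assumes "\<And>i. i \<le> D \<Longrightarrow> \<exists>v. \<forall>(x, y) \<in> R i. M x y = v"
    and "\<And>x y. (x, y) \<notin> X \<times> X \<Longrightarrow> M x y = 0"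
  shows "M \<in> adjacency_algebra D R"
proof -
  obtain v where "\<forall>i\<in>{..D}. \<forall>(x, y) \<in> R i. M x y = v i"
    using bchoice[of "{..D}" "\<lambda>i v. \<forall>(x, y) \<in> R i. M x y = v"] assms(1) by auto
  then have v: "M x y = v i" if "i \<le> D" "(x, y) \<in> R i" for i x y
    using that by auto
  have "M x y = (\<Sum>i\<le>D. v i * adjacency (R i) x y)" for x y
  proof (cases "(x, y) \<in> X \<times> X")
    case True
    then obtain k where "k \<le> D" "(x, y) \<in> R k"
      using rel_partition by blast
    then show ?thesis
      by (simp add: sum_adjacency v)
  qed (use assms(2) sum_adjacency_outside in simp)
  then have "M = (\<lambda>x y. \<Sum>i\<le>D. v i * adjacency (R i) x y)"
    by blast
  then show ?thesis
    by (auto simp: adjacency_algebra_def)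
qed

lemma range_comb_closed:
  assumes "finite I" and "\<And>i. i \<in> I \<Longrightarrow> M i \<in> range comb"
  shows "(\<lambda>x y. \<Sum>i\<in>I. c i * M i x y) \<in> range comb"
proof -
  obtain d where d: "\<And>i. i \<in> I \<Longrightarrow> M i = comb (d i)"
    using assms(2) bchoice[of I "\<lambda>i d. M i = comb d"] by blast
  have "(\<lambda>x y. \<Sum>i\<in>I. c i * M i x y) = comb (\<lambda>k. \<Sum>i\<in>I. c i * d i k)"
  proof (intro ext)
    fix x y
    have "(\<Sum>i\<in>I. c i * M i x y) = (\<Sum>i\<in>I. \<Sum>k\<le>D. c i * d i k * E k x y)"
      by (intro sum.cong refl) (simp add: d comb_def sum_distrib_left mult.assoc)
    also have "\<dots> = (\<Sum>k\<le>D. \<Sum>i\<in>I. c i * d i k * E k x y)"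
      by (rule sum.swap)
    also have "\<dots> = comb (\<lambda>k. \<Sum>i\<in>I. c i * d i k) x y"
      by (simp add: comb_def sum_distrib_right)
    finally show "(\<Sum>i\<in>I. c i * M i x y) = comb (\<lambda>k. \<Sum>i\<in>I. c i * d i k) x y" .
  qed
  then show ?thesis
    by blast
qed

text \<open>Mutual inclusion: the idempotents are constant on each relation, hence combinations of
  adjacency matrices, and \<open>adjacency_in_range_comb\<close> gives the converse.\<close>

lemma adjacency_algebra_eq: "adjacency_algebra D R = range comb"
proof (intro equalityI subsetI)
  fix M
  assume "M \<in> adjacency_algebra D R"
  then obtain c where "M = (\<lambda>x y. \<Sum>i\<in>{..D}. c i * adjacency (R i) x y)"
    by (auto simp: adjacency_algebra_def)
  then show "M \<in> range comb"
    using range_comb_closed[of "{..D}" "\<lambda>i. adjacency (R i)" c] adjacency_in_range_comb by simp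
next
  fix M
  assume "M \<in> range comb"
  then obtain c where c: "M = comb c"
    by blast
  show "M \<in> adjacency_algebra D R"
  proof (rule in_adjacency_algebra)
    fix i
    assume "i \<le> D"
    then obtain v where "\<forall>j\<in>{..D}. \<forall>(x, y) \<in> R i. E j x y = v j"
      using bchoice[of "{..D}" "\<lambda>j v. \<forall>(x, y) \<in> R i. E j x y = v"] idempotent_const by auto
    then have "\<forall>(x, y) \<in> R i. M x y = (\<Sum>j\<le>D. c j * v j)"
      by (fastforce simp: c comb_def intro!: sum.cong)
    then show "\<exists>w. \<forall>(x, y) \<in> R i. M x y = w"
      by blast
  qed (auto simp: c comb_def idempotent_support intro!: sum.neutral)
qed

lemma mult_adjacency:
  "mtx_mult X (adjacency R1) (adjacency R2) x y = real (card {z \<in> X. (x, z) \<in> R1 \<and> (z, y) \<in> R2})"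
proof -
  have "mtx_mult X (adjacency R1) (adjacency R2) x y
      = (\<Sum>z\<in>X. of_bool ((x, z) \<in> R1 \<and> (z, y) \<in> R2))"
    by (simp add: mtx_mult_def adjacency_def of_bool_conj)
  also have "\<dots> = real (card {z \<in> X. (x, z) \<in> R1 \<and> (z, y) \<in> R2})"
    using finite by (simp add: sum.If_cases of_bool_def Int_def)
  finally show ?thesis .
qed

text \<open>The span of orthogonal idempotents is closed under multiplication. The coefficient at
  \<open>k\<close> of a product of adjacency matrices is its entry at a representative pair
  \<open>w k\<close>, which counts intermediate points and so is a natural number.\<close>

lemma association_scheme: "association_scheme X D R"
proof -
  define w where "w k = (SOME u. u \<in> R k)" for k
  have w: "w k \<in> R k" if "k \<le> D" for k
    using rel_nonempty[OF that] by (auto simp: w_def some_in_eq)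
  define p where "p i j k = card {z \<in> X. (fst (w k), z) \<in> R i \<and> (z, snd (w k)) \<in> R j}" for i j k
  have "mtx_mult X (adjacency (R i)) (adjacency (R j))
      = (\<lambda>x y. \<Sum>k\<le>D. real (p i j k) * adjacency (R k) x y)" if "i \<le> D" "j \<le> D" for i j
  proof -
    have "mtx_mult X (adjacency (R i)) (adjacency (R j)) \<in> range comb"
      using adjacency_in_range_comb[OF that(1)] adjacency_in_range_comb[OF that(2)] mult_comb by auto
    then obtain c where c: "mtx_mult X (adjacency (R i)) (adjacency (R j))
        = (\<lambda>x y. \<Sum>k\<le>D. c k * adjacency (R k) x y)"
      by (auto simp: adjacency_algebra_eq[symmetric] adjacency_algebra_def)
    have "c k = real (p i j k)" if "k \<le> D" for k
    proof -
      have "(fst (w k), snd (w k)) \<in> R k"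
        using w that by simp
      then have "c k = mtx_mult X (adjacency (R i)) (adjacency (R j)) (fst (w k)) (snd (w k))"
        by (simp only: c sum_adjacency[OF that])
      then show ?thesis
        by (simp add: mult_adjacency p_def)
    qed
    then show ?thesis
      by (simp add: c)
  qed
  then have "\<exists>p :: nat \<Rightarrow> nat \<Rightarrow> nat \<Rightarrow> nat. \<forall>i\<le>D. \<forall>j\<le>D.
      mtx_mult X (adjacency (R i)) (adjacency (R j))
      = (\<lambda>x y. \<Sum>k\<le>D. real (p i j k) * adjacency (R k) x y)"
    by blast
  moreover have "adjacency (R 0) = mtx_one X"
    by (auto simp: adjacency_def mtx_one_def rel_0 fun_eq_iff Id_on_iff)
  moreover have "(\<Sum>i\<le>D. adjacency (R i) x y) = mtx_all_ones X x y" for x y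
  proof (cases "(x, y) \<in> X \<times> X")
    case True
    then obtain k where "k \<le> D" "(x, y) \<in> R k"
      using rel_partition by blast
    with True show ?thesis
      using sum_adjacency[of k x y "\<lambda>_. 1"] by (simp add: mtx_all_ones_def)
  next
    case False
    then show ?thesis
      using sum_adjacency_outside[of x y "\<lambda>_. 1"] by (auto simp: mtx_all_ones_def)
  qed
  moreover have "(\<lambda>x y. adjacency (R i) y x) = adjacency (R i)" if "i \<le> D" for i
    using rel_sym[OF that] by (auto simp: adjacency_def fun_eq_iff dest: symD)
  ultimately show ?thesis
    using finite nonempty rel_nonempty rel_subset by (auto simp: association_scheme_def)
qed

lemma idempotent_ordering:
  "E 0 = (\<lambda>x y. mtx_all_ones X x y / real (card X)) \<Longrightarrow> idempotent_ordering X D R E"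
  by (auto simp: idempotent_ordering_def bij_betw_def inj_on_E adjacency_algebra_eq
      primitive_idempotents_range_comb)

end

section \<open>Orthogonal arrays and zonal kernels\<close>

lemma nths_eq_iff:
  assumes "length x = n" "length y = n" "T \<subseteq> {..<n}"
  shows "nths x T = nths y T \<longleftrightarrow> (\<forall>k\<in>T. x ! k = y ! k)"
proof -
  have "nths z T = map ((!) z) (nths [0..<n] T)" if "length z = n" for z :: "'a list"
    using that by (metis map_nth nths_map)
  moreover have "set (nths [0..<n] T) = T"
    using assms(3) by (auto simp: set_nths) (metis lessThan_iff nth_upt plus_nat.add_0 subsetD)
  ultimately show ?thesis
    using assms by simp
qed

lemma finite_words: "finite (words n q)"
  using finite_lists_length_eq[of "{1..q}" n] by (simp add: words_def conj_commute)

text \<open>The coordinates in \<open>T\<close> of a random element of \<open>C\<close> are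
  independent and uniform, so the average of a product is the product of the averages.\<close>

lemma sum_product_hamming_design:
  fixes f :: "nat \<Rightarrow> nat \<Rightarrow> real"
  assumes design: "hamming_design t n q C" and T: "T \<subseteq> {..<n}" "card T \<le> t" and "q > 0"
  shows "(\<Sum>z\<in>C. \<Prod>k\<in>T. f k (z ! k)) = real (card C) * (\<Prod>k\<in>T. (\<Sum>a=1..q. f k a) / real q)"
proof -
  have C: "C \<subseteq> words n q" "finite C" and "t \<le> n"
    using design finite_subset finite_words by (auto simp: hamming_design_def)
  \<comment> \<open>The design condition speaks of exactly \<open>t\<close> coordinates, so
    \<open>T\<close> is enlarged to such a set; the factors at the new coordinates will be
    \<open>1\<close>.\<close>
  obtain U where U: "T \<subseteq> U" "U \<subseteq> {..<n}" "card U = t"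
    using exists_subset_between[of T t "{..<n}"] T \<open>t \<le> n\<close> by auto
  have finU: "finite U"
    using U finite_subset by blast
  have "\<exists>m. \<forall>v \<in> words t q. card {x \<in> C. nths x U = v} = m"
    using design U by (simp add: hamming_design_def)
  then obtain m where m: "\<And>v. v \<in> words t q \<Longrightarrow> card {x \<in> C. nths x U = v} = m"
    by auto
  have count: "card {x \<in> C. \<forall>k\<in>U. x ! k = w k} = m" if w: "w \<in> U \<rightarrow>\<^sub>E {1..q}" for w
  proof -
    \<comment> \<open>The entries \<open>1\<close> outside \<open>U\<close> are padding.\<close>
    define v where "v = map (\<lambda>k. if k \<in> U then w k else 1) [0..<n]"
    have v: "length v = n" "set v \<subseteq> {1..q}" "\<And>k. k \<in> U \<Longrightarrow> v ! k = w k"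
      using w U \<open>q > 0\<close> by (auto simp: v_def)
    have "{i. i < n \<and> i \<in> U} = U"
      using U by auto
    then have "nths v U \<in> words t q"
      using v set_nths_subset[of v U] U by (auto simp: words_def length_nths)
    moreover have "{x \<in> C. \<forall>k\<in>U. x ! k = w k} = {x \<in> C. nths x U = nths v U}"
      using C U v nths_eq_iff[of _ n v U] by (auto simp: words_def)
    ultimately show ?thesis
      using m by simp
  qed
  have total: "(\<Sum>z\<in>C. \<Prod>k\<in>U. g k (z ! k)) = real m * (\<Prod>k\<in>U. \<Sum>a=1..q. g k a)"
    for g :: "nat \<Rightarrow> nat \<Rightarrow> real"
  proof -
    let ?r = "\<lambda>z. restrict ((!) z) U"
    have r: "?r ` C \<subseteq> U \<rightarrow>\<^sub>E {1..q}"
      using C U by (force simp: words_def)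
    have "(\<Sum>z\<in>C. \<Prod>k\<in>U. g k (z ! k))
        = (\<Sum>w\<in>U \<rightarrow>\<^sub>E {1..q}. \<Sum>z\<in>{z \<in> C. ?r z = w}. \<Prod>k\<in>U. g k (z ! k))"
      using C finU r by (intro sum.group[symmetric] finite_PiE) auto
    also have "\<dots> = (\<Sum>w\<in>U \<rightarrow>\<^sub>E {1..q}. \<Sum>z\<in>{z \<in> C. ?r z = w}. \<Prod>k\<in>U. g k (w k))"
      by (intro sum.cong prod.cong refl) auto
    also have "\<dots> = (\<Sum>w\<in>U \<rightarrow>\<^sub>E {1..q}. real m * (\<Prod>k\<in>U. g k (w k)))"
    proof (intro sum.cong refl)
      fix w
      assume w: "w \<in> U \<rightarrow>\<^sub>E {1..q}"
      then have "{z \<in> C. ?r z = w} = {z \<in> C. \<forall>k\<in>U. z ! k = w k}"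
        by (auto simp: fun_eq_iff restrict_def PiE_def extensional_def)
      then show "(\<Sum>z\<in>{z \<in> C. ?r z = w}. \<Prod>k\<in>U. g k (w k)) = real m * (\<Prod>k\<in>U. g k (w k))"
        using count[OF w] by simp
    qed
    also have "\<dots> = real m * (\<Prod>k\<in>U. \<Sum>a=1..q. g k a)"
      using finU by (subst prod_sum_PiE) (auto simp: sum_distrib_left)
    finally show ?thesis .
  qed
  \<comment> \<open>Constant factors \<open>1\<close> relate the multiplicity \<open>m\<close> to
    the size of the array.\<close>
  have cardC: "real (card C) = real m * real q ^ t"
    using total[of "\<lambda>_ _. 1"] U by simp
  define g where "g = (\<lambda>k a. if k \<in> T then f k a else 1)"
  have "(\<Sum>z\<in>C. \<Prod>k\<in>T. f k (z ! k)) = (\<Sum>z\<in>C. \<Prod>k\<in>U. g k (z ! k))"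
    using U finU unfolding g_def by (intro sum.cong refl prod.mono_neutral_cong_left) auto
  also have "\<dots> = real m * (\<Prod>k\<in>U. real q * ((\<Sum>a=1..q. g k a) / real q))"
    using total[of g] \<open>q > 0\<close> by simp
  also have "\<dots> = real (card C) * (\<Prod>k\<in>U. (\<Sum>a=1..q. g k a) / real q)"
    using U by (simp only: prod.distrib cardC) simp
  also have "(\<Prod>k\<in>U. (\<Sum>a=1..q. g k a) / real q) = (\<Prod>k\<in>T. (\<Sum>a=1..q. f k a) / real q)"
    using U finU \<open>q > 0\<close> unfolding g_def by (intro prod.mono_neutral_cong_right) auto
  finally show ?thesis .
qed

text \<open>
  The kernel of the orthogonal projection onto the functions on \<open>V\<^sup>n\<close> that depend only on the
  coordinates in \<open>T\<close> and have mean \<open>0\<close> in each of them, up to the factor \<open>q\<^sup>n\<close>.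
\<close>

definition chi :: "nat \<Rightarrow> nat set \<Rightarrow> nat list \<Rightarrow> nat list \<Rightarrow> real" where
  "chi q T x y = (\<Prod>k\<in>T. real q * of_bool (x ! k = y ! k) - 1)"

lemma chi_commute: "chi q T x y = chi q T y x"
  by (simp add: chi_def eq_commute)

text \<open>The factor \<open>?ph\<close> has zero sum over either argument, and its convolution
  with itself is \<open>q * ?ph\<close>. Coordinates common to \<open>S\<close> and \<open>T\<close>
  thus reproduce the kernel, while one in the symmetric difference annihilates the sum.\<close>

lemma chi_convolution:
  assumes design: "hamming_design t n q C" and S: "S \<subseteq> {..<n}" and T: "T \<subseteq> {..<n}"
    and "card (S \<union> T) \<le> t" and "q > 0" and x: "x \<in> words n q" and y: "y \<in> words n q"
  shows "(\<Sum>z\<in>C. chi q S x z * chi q T z y) = (if S = T then real (card C) * chi q S x y else 0)"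
proof -
  let ?ph = "\<lambda>a b :: nat. real q * of_bool (a = b) - 1"
  define f where "f = (\<lambda>k a. (if k \<in> S then ?ph (x ! k) a else 1) * (if k \<in> T then ?ph a (y ! k) else 1))"
  have fin: "finite (S \<union> T)"
    using S T finite_subset by blast
  have "chi q S x z * chi q T z y = (\<Prod>k\<in>S \<union> T. f k (z ! k))" for z
  proof -
    have "chi q S x z = (\<Prod>k\<in>S \<union> T. if k \<in> S then ?ph (x ! k) (z ! k) else 1)"
      unfolding chi_def using fin by (intro prod.mono_neutral_cong_left) auto
    moreover have "chi q T z y = (\<Prod>k\<in>S \<union> T. if k \<in> T then ?ph (z ! k) (y ! k) else 1)"
      unfolding chi_def using fin by (intro prod.mono_neutral_cong_left) auto
    ultimately show ?thesis
      by (simp add: f_def prod.distrib)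
  qed
  then have conv: "(\<Sum>z\<in>C. chi q S x z * chi q T z y)
      = real (card C) * (\<Prod>k\<in>S \<union> T. (\<Sum>a=1..q. f k a) / real q)"
    using sum_product_hamming_design[OF design, of "S \<union> T" f] S T assms by simp
  have xy: "x ! k \<in> {1..q}" "y ! k \<in> {1..q}" if "k \<in> S \<union> T" for k
    using that S T x y by (force simp: words_def)+
  have delta: "(\<Sum>a=1..q. of_bool (b = a)) = (1::real)" "(\<Sum>a=1..q. of_bool (a = b)) = (1::real)"
    if "b \<in> {1..q}" for b
    using that by (simp_all add: of_bool_def)
  have one: "(\<Sum>a=1..q. ?ph b a) = 0" "(\<Sum>a=1..q. ?ph a b) = 0" if "b \<in> {1..q}" for b
    using delta[OF that] by (simp_all add: sum_subtractf flip: sum_distrib_left)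
  have two: "(\<Sum>a=1..q. ?ph b a * ?ph a c) = real q * ?ph b c" if "b \<in> {1..q}" "c \<in> {1..q}" for b c
  proof -
    have "(\<Sum>a=1..q. ?ph b a * ?ph a c)
        = (\<Sum>a=1..q. real q * (real q * of_bool (b = c)) * of_bool (b = a)
            - real q * of_bool (b = a) - real q * of_bool (a = c) + 1)"
      by (intro sum.cong refl) (auto simp: algebra_simps)
    also have "\<dots> = real q * ?ph b c"
      using delta that by (simp add: sum_subtractf sum.distrib algebra_simps flip: sum_distrib_left)
    finally show ?thesis .
  qed
  show ?thesis
  proof (cases "S = T")
    case True
    then have "(\<Prod>k\<in>S \<union> T. (\<Sum>a=1..q. f k a) / real q) = chi q S x y"
      using xy two \<open>q > 0\<close> by (auto simp: f_def chi_def intro!: prod.cong)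
    then show ?thesis
      using True conv by simp
  next
    case False
    then obtain k where k: "k \<in> S \<union> T" "k \<notin> S \<or> k \<notin> T"
      by blast
    then have "(\<Sum>a=1..q. f k a) = 0"
      using xy[OF k(1)] one by (auto simp: f_def)
    then have "(\<Prod>k\<in>S \<union> T. (\<Sum>a=1..q. f k a) / real q) = 0"
      using k fin by (auto simp: prod_zero_iff)
    then show ?thesis
      using False conv by simp
  qed
qed

section \<open>Kernels grouped by type of support\<close>

lemma sum_card_2_subsets_insert:
  fixes g :: "'a set \<Rightarrow> 'b::comm_monoid_add"
  assumes "finite A" and "a \<notin> A"
  shows "(\<Sum>T | T \<subseteq> insert a A \<and> card T = 2. g T)
    = (\<Sum>T | T \<subseteq> A \<and> card T = 2. g T) + (\<Sum>k\<in>A. g {a, k})"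
proof -
  have "{T. T \<subseteq> insert a A \<and> card T = 2} = {T. T \<subseteq> A \<and> card T = 2} \<union> (\<lambda>k. {a, k}) ` A"
    using assms by (auto simp: card_2_iff doubleton_eq_iff)
  moreover have "{T. T \<subseteq> A \<and> card T = 2} \<inter> (\<lambda>k. {a, k}) ` A = {}"
    using assms by auto
  moreover have "inj_on (\<lambda>k. {a, k}) A"
    by (auto simp: inj_on_def doubleton_eq_iff)
  moreover have "finite {T. T \<subseteq> A \<and> card T = 2}"
    using assms by (auto intro: finite_subset[of _ "Pow A"])
  ultimately show ?thesis
    using assms by (simp add: sum.union_disjoint sum.reindex)
qed

text \<open>Newton's identity for the second elementary symmetric polynomial; it serves to express
  \<open>zonal n q 2\<close> through \<open>zonal n q 1\<close>.\<close>

lemma sum_card_2_subsets_prod: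
  fixes f :: "'a \<Rightarrow> 'b::comm_ring_1"
  assumes "finite A"
  shows "2 * (\<Sum>T | T \<subseteq> A \<and> card T = 2. \<Prod>k\<in>T. f k) = (\<Sum>k\<in>A. f k)\<^sup>2 - (\<Sum>k\<in>A. (f k)\<^sup>2)"
  using assms
proof (induction A rule: finite_induct)
  case (insert a A)
  have pair: "(\<Sum>k\<in>A. \<Prod>l\<in>{a, k}. f l) = f a * (\<Sum>k\<in>A. f k)"
    unfolding sum_distrib_left using insert by (intro sum.cong refl, subst prod.insert) auto
  show ?case
    using insert by (simp add: sum_card_2_subsets_insert pair distrib_left power2_sum)
next
  case empty
  have "{T :: 'a set. T \<subseteq> {} \<and> card T = 2} = {}"
    by auto
  then show ?case
    by (simp only: sum.empty) simp
qed

text \<open>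
  The supports of size at most two, split by size and by whether the deleted coordinate \<open>0\<close>
  belongs to them: \<open>{}\<close>, \<open>{k}\<close>, \<open>{k, l}\<close>, \<open>{0, k}\<close>, \<open>{0}\<close> with \<open>k, l \<ge> 1\<close>. The order is the
  \<open>Q\<close>-polynomial order of the scheme.
\<close>

definition supports :: "nat \<Rightarrow> nat \<Rightarrow> nat set set" where
  "supports n j = {T. T \<subseteq> {..<n} \<and> card T \<le> 2 \<and> (if 0 \<in> T then 5 - card T else card T) = j}"

definition zonal :: "nat \<Rightarrow> nat \<Rightarrow> nat \<Rightarrow> nat list \<Rightarrow> nat list \<Rightarrow> real" where
  "zonal n q j x y = (\<Sum>T\<in>supports n j. chi q T x y)"

lemma finite_supports: "finite (supports n j)"
  by (rule finite_subset[of _ "Pow {..<n}"]) (auto simp: supports_def)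

lemma supports_simps:
  assumes "n > 0"
  shows "supports n 0 = {{}}"
    and "supports n 1 = (\<lambda>k. {k}) ` {1..<n}"
    and "supports n 2 = {T. T \<subseteq> {1..<n} \<and> card T = 2}"
    and "supports n 3 = (\<lambda>k. {0, k}) ` {1..<n}"
    and "supports n 4 = {{0}}"
proof -
  have fin: "finite T" if "T \<subseteq> {..<n}" for T
    using that finite_subset by blast
  have sub: "T \<subseteq> {1..<n} \<longleftrightarrow> T \<subseteq> {..<n} \<and> 0 \<notin> T" for T
    by (auto simp: subset_eq Suc_le_eq) (metis gr0I)
  show "supports n 0 = {{}}"
    using fin by (auto simp: supports_def)
  show "supports n 1 = (\<lambda>k. {k}) ` {1..<n}"
    by (auto simp: supports_def card_1_singleton_iff Suc_le_eq split: if_splits)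
  show "supports n 2 = {T. T \<subseteq> {1..<n} \<and> card T = 2}"
    unfolding sub by (auto simp: supports_def)
  show "supports n 3 = (\<lambda>k. {0, k}) ` {1..<n}"
  proof (intro equalityI subsetI)
    fix T
    assume "T \<in> supports n 3"
    then have T: "T \<subseteq> {..<n}" "0 \<in> T" "card T = 2"
      by (auto simp: supports_def split: if_splits)
    then obtain k where "T = {0, k}" "k \<noteq> 0"
      by (metis card_2_iff doubleton_eq_iff insertE singletonD)
    then show "T \<in> (\<lambda>k. {0, k}) ` {1..<n}"
      using T by auto
  qed (use assms in \<open>auto simp: supports_def card_insert_if\<close>)
  show "supports n 4 = {{0}}"
  proof (intro equalityI subsetI)
    fix T
    assume "T \<in> supports n 4"
    then have "0 \<in> T" "card T = 1"
      by (auto simp: supports_def split: if_splits)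
    then show "T \<in> {{0}}"
      by (auto simp: card_1_singleton_iff)
  qed (use assms in \<open>auto simp: supports_def\<close>)
qed

lemma zonal_commute: "zonal n q j x y = zonal n q j y x"
  by (simp add: zonal_def chi_commute)

lemma hamming_dist_commute: "length x = length y \<Longrightarrow> hamming_dist x y = hamming_dist y x"
  by (simp add: hamming_dist_def eq_commute)

lemma hamming_dist_eq_0_iff: "length x = length y \<Longrightarrow> hamming_dist x y = 0 \<longleftrightarrow> x = y"
  by (auto simp: hamming_dist_def intro: nth_equalityI)

lemma hamming_dist_Cons: "hamming_dist (a # x) (b # y) = of_bool (a \<noteq> b) + hamming_dist x y"
proof -
  have "{k. k < length (a # x) \<and> (a # x) ! k \<noteq> (b # y) ! k}
      = {k. k = 0 \<and> a \<noteq> b} \<union> Suc ` {k. k < length x \<and> x ! k \<noteq> y ! k}" (is "?L = ?A \<union> ?B")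
  proof (intro set_eqI)
    show "k \<in> ?L \<longleftrightarrow> k \<in> ?A \<union> ?B" for k
      by (cases k) auto
  qed
  moreover have "card (?A \<union> ?B) = card ?A + card ?B"
    by (rule card_Un_disjoint) auto
  moreover have "card ?A = of_bool (a \<noteq> b)" "card ?B = card {k. k < length x \<and> x ! k \<noteq> y ! k}"
    by (auto simp: card_image)
  ultimately show ?thesis
    by (simp add: hamming_dist_def)
qed

lemma zonal_0: "n > 0 \<Longrightarrow> zonal n q 0 x y = 1"
  unfolding zonal_def by (subst supports_simps) (auto simp: chi_def)

lemma zonal_4: "n > 0 \<Longrightarrow> zonal n q 4 x y = real q * of_bool (x ! 0 = y ! 0) - 1"
  unfolding zonal_def by (subst supports_simps) (auto simp: chi_def)

lemma zonal_1: "n > 0 \<Longrightarrow> zonal n q 1 x y = (\<Sum>k=1..<n. real q * of_bool (x ! k = y ! k) - 1)"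
  unfolding zonal_def by (subst supports_simps) (auto simp: chi_def sum.reindex)

lemma zonal_3:
  assumes "n > 0"
  shows "zonal n q 3 x y = zonal n q 4 x y * zonal n q 1 x y"
proof -
  have "inj_on (\<lambda>k. {0, k}) {1..<n}"
    by (auto simp: inj_on_def doubleton_eq_iff)
  then have "zonal n q 3 x y = (\<Sum>k=1..<n. chi q {0, k} x y)"
    unfolding zonal_def by (subst supports_simps) (auto simp: assms sum.reindex)
  also have "\<dots> = (\<Sum>k=1..<n. zonal n q 4 x y * (real q * of_bool (x ! k = y ! k) - 1))"
    by (intro sum.cong refl) (auto simp: chi_def zonal_4[OF assms])
  finally show ?thesis
    by (simp only: zonal_1[OF assms] sum_distrib_left)
qed

lemma zonal_2:
  assumes "n > 0"
  shows "2 * zonal n q 2 x y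
    = (zonal n q 1 x y)\<^sup>2 - (real q - 2) * zonal n q 1 x y - (real n - 1) * (real q - 1)"
proof -
  let ?f = "\<lambda>k. real q * of_bool (x ! k = y ! k) - 1"
  \<comment> \<open>Each factor is \<open>q - 1\<close> or \<open>-1\<close>, both roots of this
    quadratic, so the sum of squares is affine in \<open>zonal n q 1\<close>.\<close>
  have sq: "(?f k)\<^sup>2 = (real q - 2) * ?f k + (real q - 1)" for k
    by (simp add: power2_eq_square algebra_simps)
  have "2 * zonal n q 2 x y = (\<Sum>k=1..<n. ?f k)\<^sup>2 - (\<Sum>k=1..<n. (?f k)\<^sup>2)"
    unfolding zonal_def supports_simps(3)[OF assms] chi_def
    by (rule sum_card_2_subsets_prod) simp
  also have "(\<Sum>k=1..<n. (?f k)\<^sup>2) = (real q - 2) * zonal n q 1 x y + (real n - 1) * (real q - 1)"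
    using assms by (simp only: sq sum.distrib zonal_1[OF assms] sum_distrib_left[symmetric])
      (simp add: of_nat_diff)
  finally show ?thesis
    by (simp add: zonal_1[OF assms] del: One_nat_def)
qed

text \<open>The prepended letters sit at the excluded position \<open>0\<close>. Any other position
  contributes \<open>q - 1\<close> if the words agree there, and \<open>q\<close> less
  otherwise.\<close>

lemma zonal_1_Cons:
  assumes "length x = n - 1" and "n > 0"
  shows "zonal n q 1 (a # x) (b # y) = (real n - 1) * (real q - 1) - real q * real (hamming_dist x y)"
proof -
  have "zonal n q 1 (a # x) (b # y) = (\<Sum>k<length x. real q * of_bool (x ! k = y ! k) - 1)"
  proof -
    have "{1..<n} = Suc ` {..<length x}"
      using assms by (simp add: lessThan_atLeast0)
    then show ?thesis
      by (simp add: zonal_1[OF \<open>n > 0\<close>] sum.reindex del: One_nat_def)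
  qed
  also have "\<dots> = (\<Sum>k<length x. (real q - 1) - real q * of_bool (x ! k \<noteq> y ! k))"
    by (intro sum.cong) auto
  also have "\<dots> = real (length x) * (real q - 1) - real q * (\<Sum>k<length x. of_bool (x ! k \<noteq> y ! k))"
    by (simp add: sum_subtractf sum_distrib_left)
  also have "(\<Sum>k<length x. of_bool (x ! k \<noteq> y ! k)) = real (hamming_dist x y)"
    by (simp add: hamming_dist_def of_bool_def sum.If_cases Int_def)
  finally show ?thesis
    using assms by (simp add: of_nat_diff)
qed

text \<open>Strength 4 enters because the union of two supports of size at most 2 has at most 4
  elements. Different indices have disjoint families of supports, so only terms with
  \<open>S = T\<close> survive.\<close>

lemma zonal_convolution:
  assumes design: "hamming_design 4 n q C" and "q > 0" and "x \<in> words n q" and "y \<in> words n q"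
  shows "(\<Sum>z\<in>C. zonal n q i x z * zonal n q j z y)
    = (if i = j then real (card C) * zonal n q i x y else 0)"
proof -
  have conv: "(\<Sum>z\<in>C. chi q S x z * chi q T z y) = (if S = T then real (card C) * chi q S x y else 0)"
    if "S \<in> supports n i" "T \<in> supports n j" for S T
  proof (rule chi_convolution[OF design])
    show "S \<subseteq> {..<n}" "T \<subseteq> {..<n}" "card (S \<union> T) \<le> 4"
      using that card_Un_le[of S T] by (auto simp: supports_def)
  qed fact+
  have "(\<Sum>z\<in>C. zonal n q i x z * zonal n q j z y)
      = (\<Sum>z\<in>C. \<Sum>S\<in>supports n i. \<Sum>T\<in>supports n j. chi q S x z * chi q T z y)"
    by (simp add: zonal_def sum_product)
  also have "\<dots> = (\<Sum>S\<in>supports n i. \<Sum>z\<in>C. \<Sum>T\<in>supports n j. chi q S x z * chi q T z y)"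
    by (rule sum.swap)
  also have "\<dots> = (\<Sum>S\<in>supports n i. \<Sum>T\<in>supports n j. \<Sum>z\<in>C. chi q S x z * chi q T z y)"
    by (intro sum.cong refl sum.swap)
  also have "\<dots> = (\<Sum>S\<in>supports n i. \<Sum>T\<in>supports n j.
      if S = T then real (card C) * chi q S x y else 0)"
    using conv by (intro sum.cong refl) auto
  also have "\<dots> = (\<Sum>S\<in>supports n i. if S \<in> supports n j then real (card C) * chi q S x y else 0)"
    by (simp add: finite_supports)
  also have "\<dots> = (\<Sum>S\<in>supports n i. if i = j then real (card C) * chi q S x y else 0)"
    by (intro sum.cong refl) (auto simp: supports_def)
  finally show ?thesis
    by (simp add: zonal_def sum_distrib_left)
qed

text \<open>
  Tightness says that the idempotent \<open>\<Sum>j\<le>4. zonal n q j / card C\<close> has diagonal entries \<open>1\<close>, so its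
  difference with the identity is a symmetric idempotent with zero diagonal and vanishes.
\<close>

lemma sum_zonal:
  assumes tight: "tight_4_design n q C" and "q > 0" and "x \<in> C" and "y \<in> C"
  shows "(\<Sum>j\<le>4. zonal n q j x y) = real (card C) * of_bool (x = y)"
proof -
  have design: "hamming_design 4 n q C" and cardC: "card C = 1 + n * (q - 1) + (n choose 2) * (q - 1)\<^sup>2"
    using tight by (auto simp: tight_4_design_def)
  then have C: "C \<subseteq> words n q" "finite C" "n > 0"
    using finite_subset finite_words by (auto simp: hamming_design_def)
  define W where "W u v = (\<Sum>j\<le>4. zonal n q j u v)" for u v
  have diag: "W u u = real (card C)" for u
  proof -
    have z1: "zonal n q 1 u u = (real n - 1) * (real q - 1)"
      using C by (simp add: zonal_1 of_nat_diff del: One_nat_def)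
    have c2: "2 * real (n choose 2) = real n * (real n - 1)"
      using \<open>n > 0\<close> by (cases n) (auto simp: choose_two real_of_nat_div algebra_simps)
    have z2: "2 * zonal n q 2 u u = ((real n - 1) * (real q - 1))\<^sup>2
        - (real q - 2) * ((real n - 1) * (real q - 1)) - (real n - 1) * (real q - 1)"
      using zonal_2[OF \<open>n > 0\<close>, of q u u] z1 by simp
    have "2 * W u u = 2 + 2 * ((real n - 1) * (real q - 1)) + 2 * zonal n q 2 u u
        + 2 * ((real q - 1) * ((real n - 1) * (real q - 1))) + 2 * (real q - 1)"
      using C z1 by (simp add: W_def numeral_eq_Suc)
        (simp add: zonal_0 zonal_3 zonal_4 flip: numeral_eq_Suc One_nat_def)
    also have "\<dots> = 2 + 2 * real n * (real q - 1) + 2 * real (n choose 2) * (real q - 1)\<^sup>2"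
      unfolding c2 z2 by (simp add: power2_eq_square algebra_simps)
    also have "\<dots> = 2 * real (card C)"
      using \<open>q > 0\<close> by (simp add: cardC of_nat_diff)
    finally show ?thesis
      by simp
  qed
  have conv: "(\<Sum>z\<in>C. W u z * W z u) = real (card C) * W u u" if "u \<in> C" for u
  proof -
    have "(\<Sum>z\<in>C. W u z * W z u) = (\<Sum>z\<in>C. \<Sum>i\<le>4. \<Sum>j\<le>4. zonal n q i u z * zonal n q j z u)"
      by (simp add: W_def sum_product)
    also have "\<dots> = (\<Sum>i\<le>4. \<Sum>z\<in>C. \<Sum>j\<le>4. zonal n q i u z * zonal n q j z u)"
      by (rule sum.swap)
    also have "\<dots> = (\<Sum>i\<le>4. \<Sum>j\<le>4. \<Sum>z\<in>C. zonal n q i u z * zonal n q j z u)"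
      by (intro sum.cong refl sum.swap)
    also have "\<dots> = (\<Sum>i\<le>4. \<Sum>j\<le>4. if i = j then real (card C) * zonal n q i u u else 0)"
      using that C \<open>q > 0\<close> by (intro sum.cong refl zonal_convolution[OF design]) auto
    also have "\<dots> = real (card C) * W u u"
      by (simp add: W_def sum_distrib_left)
    finally show ?thesis .
  qed
  \<comment> \<open>The squared norm of row \<open>x\<close> of \<open>W\<close> minus
    \<open>?N\<close> times the identity is expanded; the diagonal value \<open>?N\<close> of
    \<open>W\<close> makes it zero.\<close>
  let ?N = "real (card C)"
  have "(\<Sum>z\<in>C. (W x z - ?N * of_bool (x = z))\<^sup>2)
      = (\<Sum>z\<in>C. W x z * W z x - 2 * ?N * (if x = z then W x x else 0) + (if x = z then ?N\<^sup>2 else 0))"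
    by (intro sum.cong refl) (auto simp: W_def zonal_commute[of n q _ x] power2_eq_square algebra_simps)
  also have "\<dots> = ?N * W x x - 2 * ?N * W x x + ?N\<^sup>2"
    using C \<open>x \<in> C\<close> by (simp add: sum.distrib sum_subtractf conv flip: sum_distrib_left)
  also have "\<dots> = 0"
    by (simp add: diag power2_eq_square)
  finally have "\<forall>z\<in>C. (W x z - ?N * of_bool (x = z))\<^sup>2 = 0"
    using C by (subst (asm) sum_nonneg_eq_0_iff) auto
  then show ?thesis
    using \<open>y \<in> C\<close> by (simp add: W_def)
qed

section \<open>The projection of a tight 4-design\<close>

lemma sum_atMost_4: "(\<Sum>j\<le>4. f j) = f 0 + f 1 + f 2 + f 3 + f (4 :: nat)"
  by (simp add: numeral_eq_Suc)

lemma le_4_cases: "j \<le> 4 \<longleftrightarrow> j = 0 \<or> j = 1 \<or> j = 2 \<or> j = 3 \<or> j = (4 :: nat)"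
  by auto

text \<open>For \<open>s\<close> false, and for \<open>s\<close> true off the diagonal, only two
  distances occur, with the same difference \<delta>, so each indicator is a linear interpolation in
  \<open>d\<close>. The gaps keep the five distances distinct.\<close>

lemma distance_interpolation:
  fixes d \<alpha>1 \<alpha>2 i :: nat and s e :: bool
  assumes gaps: "2 \<le> \<alpha>1" "\<alpha>1 + 2 \<le> \<alpha>2" and i: "i \<le> 4"
    and d: "e \<and> s \<and> d = 0 \<or> \<not> e \<and> \<not> s \<and> d = \<alpha>1 - 1 \<or> \<not> e \<and> s \<and> d = \<alpha>1 \<or>
      \<not> e \<and> \<not> s \<and> d = \<alpha>2 - 1 \<or> \<not> e \<and> s \<and> d = \<alpha>2"
  shows "of_bool (d = [0, \<alpha>1 - 1, \<alpha>1, \<alpha>2 - 1, \<alpha>2] ! i) =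
    (let s = of_bool s; d = real d; \<delta> = real \<alpha>2 - real \<alpha>1 in
      [of_bool e, ((real \<alpha>2 - 1) * (1 - s) - (1 - s) * d) / \<delta>,
       (real \<alpha>2 * (s - of_bool e) - s * d) / \<delta>,
       - ((real \<alpha>1 - 1) * (1 - s) - (1 - s) * d) / \<delta>,
       - (real \<alpha>1 * (s - of_bool e) - s * d) / \<delta>] ! i)"
proof -
  \<comment> \<open>This substitution removes truncated subtraction.\<close>
  obtain a b where ab: "\<alpha>1 = Suc (Suc a)" "\<alpha>2 = Suc (Suc (Suc (Suc (a + b))))"
    using gaps that[of "\<alpha>1 - 2" "\<alpha>2 - \<alpha>1 - 2"] by simp
  have "i = 0 \<or> i = 1 \<or> i = 2 \<or> i = 3 \<or> i = 4"
    using i by (simp add: le_4_cases)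
  then show ?thesis
    using d by (elim disjE conjE) (simp_all add: ab Let_def)
qed

section \<open>The two distances of a tight design\<close>

locale tight_design =
  fixes n q \<alpha>1 \<alpha>2 :: nat and C :: "nat list set"
  assumes q_ge_2: "q \<ge> 2"
    and tight: "tight_4_design n q C"
    and degrees: "degree_set C = {\<alpha>1, \<alpha>2}" and degrees_less: "\<alpha>1 < \<alpha>2"
begin

lemma design: "hamming_design 4 n q C"
  using tight by (simp add: tight_4_design_def)

lemma n_ge_4: "n \<ge> 4"
  using design by (simp add: hamming_design_def)

lemma n_pos: "n > 0"
  using n_ge_4 by simp

lemma C_subset: "C \<subseteq> words n q"
  using design by (simp add: hamming_design_def)

lemma finite_C: "finite C"
  using C_subset finite_words finite_subset by blast

lemma card_C_pos: "card C > 0"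
  using tight by (simp add: tight_4_design_def)

lemma C_Cons:
  assumes "u \<in> C"
  obtains a x where "u = a # x" "a \<in> {1..q}"
proof -
  have "length u = n" "set u \<subseteq> {1..q}"
    using assms C_subset by (auto simp: words_def)
  then show thesis
    using that n_pos by (cases u) auto
qed

lemma degree_obtain:
  assumes "d \<in> {\<alpha>1, \<alpha>2}"
  obtains u v where "u \<in> C" "v \<in> C" "u \<noteq> v" "d = hamming_dist u v"
proof -
  have "d \<in> degree_set C"
    using assms degrees by simp
  then show thesis
    using that by (auto simp: degree_set_def)
qed

text \<open>The diagonal value of \<open>zonal n q 1\<close>, and so the trace of the idempotent
  \<open>E 1\<close> defined below.\<close>

definition mult_1 :: "real" where
  "mult_1 = (real n - 1) * (real q - 1)"

lemma zonal_1_mult_1: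
  "a # x \<in> C \<Longrightarrow> zonal n q 1 (a # x) (b # y) = mult_1 - real q * real (hamming_dist x y)"
  using C_subset n_pos by (subst zonal_1_Cons) (auto simp: words_def mult_1_def)

text \<open>Here \<open>t\<close> is the first Krawtchouk polynomial at \<open>d\<close>. By
  \<open>sum_zonal\<close> the Krawtchouk polynomials of degree 0, 1, 2 add up to zero at the
  distance of two distinct codewords; the quadratic is twice this sum.\<close>

lemma degree_quadratic:
  assumes "d \<in> {\<alpha>1, \<alpha>2}"
  defines "t \<equiv> real n * (real q - 1) - real q * real d"
  shows "t\<^sup>2 - (real q - 4) * t + 2 - real n * (real q - 1) = 0"
proof -
  obtain u v where uv: "u \<in> C" "v \<in> C" "u \<noteq> v" "d = hamming_dist u v"
    using assms(1) by (rule degree_obtain)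
  then obtain a x b y where ab: "u = a # x" "v = b # y"
    by (metis C_Cons)
  let ?z = "\<lambda>j. zonal n q j u v"
  have "?z 0 + ?z 1 + ?z 2 + ?z 3 + ?z 4 = 0"
    using sum_zonal[OF tight _ uv(1,2)] q_ge_2 uv(3) by (simp add: sum_atMost_4)
  then have sum: "1 + ?z 1 + ?z 2 + ?z 4 * ?z 1 + ?z 4 = 0"
    by (simp only: zonal_0[OF n_pos] zonal_3[OF n_pos])
  have z1: "?z 1 = mult_1 - real q * real (hamming_dist x y)"
    using zonal_1_mult_1 uv ab by simp
  have z4: "?z 4 = real q * of_bool (a = b) - 1"
    using zonal_4[OF n_pos] ab by simp
  \<comment> \<open>The deleted coordinate contributes \<open>?z 4\<close>, the others
    \<open>?z 1\<close>.\<close>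
  have t: "t = ?z 1 + ?z 4"
    unfolding t_def z1 z4 uv(4) mult_1_def unfolding ab hamming_dist_Cons by (auto simp: algebra_simps)
  have sq4: "(?z 4)\<^sup>2 = (real q - 2) * ?z 4 + (real q - 1)"
    unfolding z4 by (auto simp: power2_eq_square algebra_simps)
  show ?thesis
    using sum zonal_2[OF n_pos, of q u v] sq4 unfolding t by algebra
qed

lemma degree_ge_2: "\<alpha>1 \<ge> 2"
proof -
  obtain u v where uv: "u \<in> C" "v \<in> C" "u \<noteq> v" "\<alpha>1 = hamming_dist u v"
    by (rule degree_obtain[of \<alpha>1]) auto
  then have "\<alpha>1 \<noteq> 0"
    using hamming_dist_eq_0_iff[of u v] C_subset by (auto simp: words_def subset_eq)
  moreover have "\<alpha>1 \<noteq> 1"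
  proof
    assume "\<alpha>1 = 1"
    \<comment> \<open>At distance 1 one has \<open>t = (n - 1) * (q - 1) - 1\<close>, for which the
      quadratic collapses to this product.\<close>
    then have "(real n - 1) * (real n - 2) * (real q - 1)\<^sup>2 = 0"
      using degree_quadratic[of \<alpha>1] by (simp add: power2_eq_square algebra_simps)
    then show False
      using n_ge_4 q_ge_2 by auto
  qed
  ultimately show ?thesis
    by simp
qed

text \<open>Consecutive distances would give roots \<open>t\<close> and \<open>t + q\<close> of a
  quadratic whose roots add up to \<open>q - 4\<close>; hence \<open>t = -2\<close>, and
  substitution leaves \<open>n = 2\<close>.\<close>

lemma degree_gap: "\<alpha>1 + 2 \<le> \<alpha>2"
proof -
  have "\<alpha>2 \<noteq> \<alpha>1 + 1"
  proof
    assume gap: "\<alpha>2 = \<alpha>1 + 1"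
    define t where "t = real n * (real q - 1) - real q * real \<alpha>2"
    have eq2: "t\<^sup>2 - (real q - 4) * t + 2 - real n * (real q - 1) = 0"
      using degree_quadratic[of \<alpha>2] by (simp add: t_def)
    have "real n * (real q - 1) - real q * real \<alpha>1 = t + real q"
      by (simp add: t_def gap algebra_simps)
    then have eq1: "(t + real q)\<^sup>2 - (real q - 4) * (t + real q) + 2 - real n * (real q - 1) = 0"
      using degree_quadratic[of \<alpha>1] by simp
    have "real q * (2 * t + 4) = 0"
      using eq1 eq2 by algebra
    then have "t = - 2"
      using q_ge_2 by simp
    then have "(real n - 2) * (real q - 1) = 0"
      using eq2 by (simp add: algebra_simps)
    then show False
      using n_ge_4 q_ge_2 by simp
  qed
  then show ?thesis
    using degrees_less by simp
qed

section \<open>Deletion of the first coordinate\<close>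

abbreviation X :: "nat list set" where
  "X \<equiv> tilde_code q C"

abbreviation R :: "nat \<Rightarrow> (nat list \<times> nat list) set" where
  "R \<equiv> tilde_rel q C \<alpha>1 \<alpha>2"

text \<open>Codewords with the same tail are at distance at most 1, hence equal, so on
  \<open>X\<close> there is only one letter to choose. Outside \<open>X\<close> the value is
  arbitrary.\<close>

definition lead :: "nat list \<Rightarrow> nat" where
  "lead x = (SOME a. a # x \<in> C)"

lemma lead_in: "x \<in> X \<Longrightarrow> lead x # x \<in> C"
  unfolding lead_def by (rule someI_ex) (auto simp: tilde_code_def derived_code_def)

lemma X_length: "x \<in> X \<Longrightarrow> length x = n - 1"
  using lead_in C_subset by (force simp: words_def)

lemma degree_cases:
  assumes "u \<in> C" "v \<in> C" "u \<noteq> v"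
  shows "hamming_dist u v = \<alpha>1 \<or> hamming_dist u v = \<alpha>2"
  using assms degrees unfolding degree_set_def by blast

lemma lead_unique:
  assumes "a # x \<in> C"
  shows "lead x = a"
proof (rule ccontr)
  assume "lead x \<noteq> a"
  moreover have "lead x # x \<in> C"
    unfolding lead_def by (rule someI_ex) (use assms in blast)
  ultimately have "hamming_dist (lead x # x) (a # x) = \<alpha>1 \<or> hamming_dist (lead x # x) (a # x) = \<alpha>2"
    using assms degree_cases by auto
  moreover have "hamming_dist (lead x # x) (a # x) \<le> 1"
    using hamming_dist_eq_0_iff[of x x] by (simp add: hamming_dist_Cons)
  ultimately show False
    using degree_ge_2 degrees_less by simp
qed

lemma bij_lead: "bij_betw (\<lambda>x. lead x # x) X C"
proof (rule bij_betw_byWitness[where f' = tl])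
  show "tl ` C \<subseteq> X"
  proof (intro image_subsetI)
    fix u
    assume "u \<in> C"
    moreover from this obtain a x where "u = a # x" "a \<in> {1..q}"
      by (rule C_Cons)
    ultimately show "tl u \<in> X"
      by (auto simp: tilde_code_def derived_code_def)
  qed
  show "\<forall>u\<in>C. lead (tl u) # tl u = u"
    by (metis C_Cons lead_unique list.sel(3))
qed (use lead_in in auto)

lemma card_X: "card X = card C"
  using bij_lead by (rule bij_betw_same_card)

lemma finite_X: "finite X"
  using bij_lead finite_C bij_betw_finite by blast

lemma X_nonempty: "X \<noteq> {}"
  using card_X card_C_pos by auto

text \<open>For distinct words, restoring the leading letters yields distance
  \<open>\<alpha>1\<close> or \<open>\<alpha>2\<close>; deleting them lowers it by 1 exactly when
  they differ.\<close>

lemma pair_cases: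
  assumes "x \<in> X" "y \<in> X"
  obtains "x = y" "lead x = lead y" "hamming_dist x y = 0"
    | "x \<noteq> y" "lead x \<noteq> lead y" "hamming_dist x y = \<alpha>1 - 1"
    | "x \<noteq> y" "lead x = lead y" "hamming_dist x y = \<alpha>1"
    | "x \<noteq> y" "lead x \<noteq> lead y" "hamming_dist x y = \<alpha>2 - 1"
    | "x \<noteq> y" "lead x = lead y" "hamming_dist x y = \<alpha>2"
proof (cases "x = y")
  case True
  then show ?thesis
    using that(1) hamming_dist_eq_0_iff[of x y] by simp
next
  case False
  then have "hamming_dist (lead x # x) (lead y # y) \<in> {\<alpha>1, \<alpha>2}"
    using assms lead_in degree_cases by simp
  then show ?thesis
    using False that degree_ge_2 degrees_less
    by (cases "lead x = lead y") (auto simp: hamming_dist_Cons)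
qed

lemma rel_iff:
  "(x, y) \<in> R k \<longleftrightarrow> x \<in> X \<and> y \<in> X \<and> hamming_dist x y = [0, \<alpha>1 - 1, \<alpha>1, \<alpha>2 - 1, \<alpha>2] ! k"
  by (auto simp: tilde_rel_def)

lemma distances_distinct:
  "0 < \<alpha>1 - 1" "0 < \<alpha>1" "0 < \<alpha>2 - 1" "0 < \<alpha>2" "\<alpha>1 - 1 \<noteq> \<alpha>1" "\<alpha>1 - 1 \<noteq> \<alpha>2 - 1" "\<alpha>1 - 1 \<noteq> \<alpha>2"
  "\<alpha>1 \<noteq> \<alpha>2 - 1" "\<alpha>1 \<noteq> \<alpha>2" "\<alpha>2 - 1 \<noteq> \<alpha>2"
  using degree_ge_2 degree_gap by auto

text \<open>The relations are defined by distance alone, whereas the kernels also see the deleted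
  letter; the parity of the index recovers whether these letters agree.\<close>

lemma rel_lead:
  assumes "(x, y) \<in> R k" and "k \<le> 4"
  shows "lead x = lead y \<longleftrightarrow> even k"
proof -
  have xy: "x \<in> X" "y \<in> X"
    using assms by (auto simp: rel_iff)
  show ?thesis
    using xy
  proof (cases rule: pair_cases)
  qed (use assms distances_distinct in \<open>auto simp: rel_iff le_4_cases\<close>)
qed

lemma rel_partition:
  assumes "x \<in> X" "y \<in> X"
  shows "\<exists>!k. k \<le> 4 \<and> (x, y) \<in> R k"
proof -
  have ex: "\<exists>k\<le>4. (x, y) \<in> R k"
    using assms
  proof (cases rule: pair_cases)
    case 1
    then show ?thesis
      using assms by (intro exI[of _ 0]) (simp add: rel_iff)
  next
    case 2
    then show ?thesis
      using assms by (intro exI[of _ 1]) (simp add: rel_iff)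
  next
    case 3
    then show ?thesis
      using assms by (intro exI[of _ 2]) (simp add: rel_iff)
  next
    case 4
    then show ?thesis
      using assms by (intro exI[of _ 3]) (simp add: rel_iff)
  next
    case 5
    then show ?thesis
      using assms by (intro exI[of _ 4]) (simp add: rel_iff)
  qed
  have "distinct [0, \<alpha>1 - 1, \<alpha>1, \<alpha>2 - 1, \<alpha>2]"
    using distances_distinct by auto
  then have "k = l" if "k \<le> 4" "l \<le> 4" "(x, y) \<in> R k" "(x, y) \<in> R l" for k l
    using that nth_eq_iff_index_eq[of "[0, \<alpha>1 - 1, \<alpha>1, \<alpha>2 - 1, \<alpha>2]" k l] by (simp add: rel_iff)
  then show ?thesis
    using ex by blast
qed

section \<open>The five idempotents and the adjacency matrices\<close>

definition E :: "nat \<Rightarrow> nat list mtx" where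
  "E j x y = (if x \<in> X \<and> y \<in> X then zonal n q j (lead x # x) (lead y # y) / real (card C) else 0)"

text \<open>Closed form of the kernels in terms of agreement of the leading letters and distance,
  which shows them constant on each relation. Entry 2 is \<open>zonal_2\<close> solved for its
  left-hand side.\<close>

definition zonal_value :: "nat \<Rightarrow> bool \<Rightarrow> nat \<Rightarrow> real" where
  "zonal_value j s d =
    (let z1 = mult_1 - real q * real d; z4 = real q * of_bool s - 1
     in [1, z1, (z1\<^sup>2 - (real q - 2) * z1 - mult_1) / 2, z4 * z1, z4] ! j)"

lemma zonal_eq_value:
  assumes "x \<in> X" and "j \<le> 4"
  shows "zonal n q j (lead x # x) (lead y # y) = zonal_value j (lead x = lead y) (hamming_dist x y)"
proof -
  let ?z = "\<lambda>j. zonal n q j (lead x # x) (lead y # y)"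
  have z1: "?z 1 = mult_1 - real q * real (hamming_dist x y)"
    using assms lead_in zonal_1_mult_1 by blast
  have z4: "?z 4 = real q * of_bool (lead x = lead y) - 1"
    using zonal_4[OF n_pos] by simp
  have z2: "?z 2 = ((?z 1)\<^sup>2 - (real q - 2) * ?z 1 - mult_1) / 2"
    using zonal_2[OF n_pos, of q "lead x # x" "lead y # y"] by (simp add: mult_1_def)
  have z0: "?z 0 = 1" and z3: "?z 3 = ?z 4 * ?z 1"
    by (simp_all add: zonal_0[OF n_pos] zonal_3[OF n_pos])
  consider "j = 0" | "j = 1" | "j = 2" | "j = 3" | "j = 4"
    using assms(2) by (auto simp: le_4_cases)
  then show ?thesis
  proof cases
    case 1
    then show ?thesis by (simp add: z0 zonal_value_def Let_def)
  next
    case 2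
    then show ?thesis unfolding 2 z1 by (simp add: zonal_value_def Let_def)
  next
    case 3
    then show ?thesis unfolding 3 z2 z1 by (simp add: zonal_value_def Let_def)
  next
    case 4
    then show ?thesis unfolding 4 z3 z4 z1 by (simp add: zonal_value_def Let_def)
  next
    case 5
    then show ?thesis unfolding 5 z4 by (simp add: zonal_value_def Let_def)
  qed
qed

lemma E_eq_value:
  assumes "x \<in> X" "y \<in> X" "j \<le> 4"
  shows "E j x y = zonal_value j (lead x = lead y) (hamming_dist x y) / real (card C)"
  using assms by (simp add: E_def zonal_eq_value)

lemma zonal_value_simps:
  "zonal_value 0 s d = 1"
  "zonal_value 1 s d = mult_1 - real q * real d"
  "zonal_value 3 s d = zonal_value 4 s d * zonal_value 1 s d"
  "zonal_value 4 s d = real q * of_bool s - 1"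
  by (simp_all add: zonal_value_def Let_def)

lemma zonal_value_2:
  "(zonal_value 1 s d)\<^sup>2 = 2 * zonal_value 2 s d + (real q - 2) * zonal_value 1 s d + mult_1"
  by (simp add: zonal_value_def Let_def field_simps)

lemma sum_zonal_value:
  assumes "x \<in> X" "y \<in> X"
  defines "z \<equiv> \<lambda>j. zonal_value j (lead x = lead y) (hamming_dist x y)"
  shows "1 + z 1 + z 2 + z 4 * z 1 + z 4 = real (card C) * of_bool (x = y)"
proof -
  have "(\<Sum>j\<le>4. z j) = (\<Sum>j\<le>4. zonal n q j (lead x # x) (lead y # y))"
    using assms zonal_eq_value by (intro sum.cong refl) auto
  also have "\<dots> = real (card C) * of_bool (x = y)"
    using assms q_ge_2 lead_in by (subst sum_zonal[OF tight]) auto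
  finally show ?thesis
    unfolding sum_atMost_4 z_def zonal_value_simps(1,3) by simp
qed

text \<open>The bijection \<open>bij_lead\<close> turns sums over \<open>X\<close> into sums over
  \<open>C\<close>, where \<open>zonal_convolution\<close> applies; division by
  \<open>card C\<close> normalizes the kernels.\<close>

sublocale orthogonal_idempotents X 4 E
proof
  fix i j :: nat
  assume "i \<le> 4" "j \<le> 4"
  show "mtx_mult X (E i) (E j) = (if i = j then E i else mtx_zero)"
  proof (intro ext)
    fix x y
    show "mtx_mult X (E i) (E j) x y = (if i = j then E i else mtx_zero) x y"
    proof (cases "x \<in> X \<and> y \<in> X")
      case True
      let ?f = "\<lambda>x. lead x # x"
      have "mtx_mult X (E i) (E j) x y
          = (\<Sum>z\<in>X. zonal n q i (?f x) (?f z) * zonal n q j (?f z) (?f y)) / (real (card C))\<^sup>2"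
        using True by (simp add: mtx_mult_def E_def power2_eq_square sum_divide_distrib)
      also have "(\<Sum>z\<in>X. zonal n q i (?f x) (?f z) * zonal n q j (?f z) (?f y))
          = (\<Sum>z\<in>C. zonal n q i (?f x) z * zonal n q j z (?f y))"
        using bij_lead by (rule sum.reindex_bij_betw)
      also have "\<dots> = (if i = j then real (card C) * zonal n q i (?f x) (?f y) else 0)"
        using True lead_in C_subset q_ge_2 by (intro zonal_convolution[OF design]) auto
      finally show ?thesis
        using True card_C_pos by (cases "i = j") (simp_all add: mtx_zero_def power2_eq_square E_def[of _ x y])
    qed (auto simp: mtx_mult_def E_def mtx_zero_def)
  qed
next
  fix j :: nat
  assume j: "j \<le> 4"
  obtain x where x: "x \<in> X"
    using X_nonempty by blast
  have d: "hamming_dist x x = 0"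
    using hamming_dist_eq_0_iff by blast
  \<comment> \<open>The bound \<open>mult_1 > q - 1\<close> keeps the diagonal value of the kernel
    with index 2 from vanishing.\<close>
  have pos: "mult_1 > 0" "mult_1 > real q - 1" "real q > 1"
    using n_ge_4 q_ge_2 by (auto simp: mult_1_def)
  have "zonal_value 2 True 0 = mult_1 * (mult_1 - (real q - 1)) / 2"
    by (simp add: zonal_value_def Let_def power2_eq_square algebra_simps)
  then have "zonal_value j True 0 \<noteq> 0"
    using j pos by (auto simp: le_4_cases zonal_value_simps simp del: One_nat_def)
  then have "E j x x \<noteq> 0"
    using x j d card_C_pos by (simp add: E_eq_value)
  then show "E j \<noteq> mtx_zero"
    by (auto simp: mtx_zero_def)
qed

text \<open>
  The coefficients of the adjacency matrices in the basis of idempotents. They come from writing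
  the identity \<open>I\<close>, the all-ones matrix \<open>J\<close>, the matrix \<open>S\<close> of the partition by leading letters,
  the distance matrix \<open>\<Delta>\<close> and the entrywise product \<open>S \<circ> \<Delta>\<close> in terms of the idempotents, and solving
  \<open>S - I = A\<^sub>2 + A\<^sub>4\<close>, \<open>S \<circ> \<Delta> = \<alpha>\<^sub>1 A\<^sub>2 + \<alpha>\<^sub>2 A\<^sub>4\<close>, \<open>J - S = A\<^sub>1 + A\<^sub>3\<close>,
  \<open>\<Delta> - S \<circ> \<Delta> = (\<alpha>\<^sub>1 - 1) A\<^sub>1 + (\<alpha>\<^sub>2 - 1) A\<^sub>3\<close>.
\<close>

definition within_coeff :: "real \<Rightarrow> nat \<Rightarrow> real" where
  "within_coeff a j = (let N = real (card C); Q = real q in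
    [a * (N / Q - 1) - N * mult_1 / Q\<^sup>2, N / Q\<^sup>2 - a, - a, N / Q\<^sup>2 - a,
     a * (N / Q - 1) - N * mult_1 / Q\<^sup>2] ! j)"

definition between_coeff :: "real \<Rightarrow> nat \<Rightarrow> real" where
  "between_coeff a j = (let N = real (card C); Q = real q in
    [a * (N - N / Q) - N * mult_1 / Q + N * mult_1 / Q\<^sup>2, N / Q - N / Q\<^sup>2, 0, - N / Q\<^sup>2,
     N * mult_1 / Q\<^sup>2 - a * N / Q] ! j)"

text \<open>Eliminating \<open>?z 2\<close> by \<open>sum_zonal_value\<close> leaves linear
  expressions in \<open>1\<close>, the diagonal indicator, \<open>s\<close>, \<open>d\<close> and
  \<open>s * d\<close>, whose coefficients match.\<close>

lemma sum_coeff: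
  assumes "x \<in> X" "y \<in> X"
  defines "s \<equiv> of_bool (lead x = lead y) :: real" and "d \<equiv> real (hamming_dist x y)"
  shows "comb (within_coeff a) x y = a * (s - of_bool (x = y)) - s * d"
    and "comb (between_coeff a) x y = a * (1 - s) - (1 - s) * d"
    and "comb (\<lambda>_. 1) x y = of_bool (x = y)"
proof -
  let ?z = "\<lambda>j. zonal_value j (lead x = lead y) (hamming_dist x y)"
  define N where "N = real (card C)"
  define Q where "Q = real q"
  have pos: "N \<noteq> 0" "Q \<noteq> 0"
    using card_C_pos q_ge_2 by (auto simp: N_def Q_def)
  have z1: "?z 1 = mult_1 - Q * d" and z4: "?z 4 = Q * s - 1"
    unfolding zonal_value_simps by (simp_all add: Q_def s_def d_def)
  have z2: "?z 2 = N * of_bool (x = y) - 1 - (mult_1 - Q * d) - (Q * s - 1) * (mult_1 - Q * d) - (Q * s - 1)"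
    using sum_zonal_value[OF assms(1,2)] unfolding z1 z4 N_def by simp
  have comb_eq: "comb c x y = (c 0 + c 1 * (mult_1 - Q * d)
      + c 2 * (N * of_bool (x = y) - 1 - (mult_1 - Q * d) - (Q * s - 1) * (mult_1 - Q * d) - (Q * s - 1))
      + c 3 * ((Q * s - 1) * (mult_1 - Q * d)) + c 4 * (Q * s - 1)) / N" for c
  proof -
    have "comb c x y = (\<Sum>j\<le>4. c j * (?z j / N))"
      unfolding comb_def using assms by (intro sum.cong refl) (simp add: E_eq_value N_def)
    also have "\<dots> = (c 0 * ?z 0 + c 1 * ?z 1 + c 2 * ?z 2 + c 3 * (?z 4 * ?z 1) + c 4 * ?z 4) / N"
      unfolding sum_atMost_4 zonal_value_simps(3) by (simp add: add_divide_distrib)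
    finally show ?thesis
      unfolding z2 z1 z4 zonal_value_simps(1) by simp
  qed
  show "comb (\<lambda>_. 1) x y = of_bool (x = y)"
    unfolding comb_eq using pos by simp
  show "comb (within_coeff a) x y = a * (s - of_bool (x = y)) - s * d"
    unfolding comb_eq within_coeff_def Let_def N_def[symmetric] Q_def[symmetric]
    using pos by (simp add: field_simps power2_eq_square)
  show "comb (between_coeff a) x y = a * (1 - s) - (1 - s) * d"
    unfolding comb_eq between_coeff_def Let_def N_def[symmetric] Q_def[symmetric]
    using pos by (simp add: field_simps power2_eq_square)
qed

text \<open>Row 0 is constantly \<open>1\<close> because the idempotents sum to the identity; the
  other rows interpolate linearly in the distance.\<close>

definition adjacency_coeff :: "nat \<Rightarrow> nat \<Rightarrow> real" where
  "adjacency_coeff i j = (let \<delta> = real \<alpha>2 - real \<alpha>1 in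
    [1, between_coeff (real \<alpha>2 - 1) j / \<delta>, within_coeff (real \<alpha>2) j / \<delta>,
     - between_coeff (real \<alpha>1 - 1) j / \<delta>, - within_coeff (real \<alpha>1) j / \<delta>] ! i)"

lemma comb_scale:
  "comb (\<lambda>j. c j / b) x y = comb c x y / b"
  "comb (\<lambda>j. - (c j / b)) x y = - (comb c x y / b)"
  by (simp_all add: comb_def sum_divide_distrib sum_negf)

lemma adjacency_eq_comb:
  assumes "i \<le> 4"
  shows "adjacency (R i) = comb (adjacency_coeff i)"
proof (intro ext)
  fix x y
  show "adjacency (R i) x y = comb (adjacency_coeff i) x y"
  proof (cases "x \<in> X \<and> y \<in> X")
    case False
    then show ?thesis
      by (auto simp: adjacency_def rel_iff comb_def E_def)
  next
    case True
    note coeff = sum_coeff[OF conjunct1[OF True] conjunct2[OF True]]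
    have adj: "adjacency (R i) x y = of_bool (hamming_dist x y = [0, \<alpha>1 - 1, \<alpha>1, \<alpha>2 - 1, \<alpha>2] ! i)"
      using True by (simp add: adjacency_def rel_iff)
    consider "i = 0" | "i = 1" | "i = 2" | "i = 3" | "i = 4"
      using assms by (auto simp: le_4_cases)
    then have "comb (adjacency_coeff i) x y =
      (let s = of_bool (lead x = lead y); d = real (hamming_dist x y); \<delta> = real \<alpha>2 - real \<alpha>1 in
      [of_bool (x = y), ((real \<alpha>2 - 1) * (1 - s) - (1 - s) * d) / \<delta>,
       (real \<alpha>2 * (s - of_bool (x = y)) - s * d) / \<delta>,
       - ((real \<alpha>1 - 1) * (1 - s) - (1 - s) * d) / \<delta>,
       - (real \<alpha>1 * (s - of_bool (x = y)) - s * d) / \<delta>] ! i)" (is "_ = ?rhs")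
      by cases (simp_all add: adjacency_coeff_def[abs_def] Let_def comb_scale coeff,
          simp_all add: minus_divide_left del: divide_minus_left)
    moreover have "adjacency (R i) x y = ?rhs"
      unfolding adj
    proof (rule distance_interpolation)
      have "x \<in> X" "y \<in> X"
        using True by auto
      then show "x = y \<and> lead x = lead y \<and> hamming_dist x y = 0
          \<or> x \<noteq> y \<and> lead x \<noteq> lead y \<and> hamming_dist x y = \<alpha>1 - 1
          \<or> x \<noteq> y \<and> lead x = lead y \<and> hamming_dist x y = \<alpha>1
          \<or> x \<noteq> y \<and> lead x \<noteq> lead y \<and> hamming_dist x y = \<alpha>2 - 1
          \<or> x \<noteq> y \<and> lead x = lead y \<and> hamming_dist x y = \<alpha>2"
        by (rule pair_cases) simp_all
    qed (fact degree_ge_2 degree_gap assms)+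
    ultimately show ?thesis
      by simp
  qed
qed

text \<open>An empty relation would have only zero coefficients in the basis of idempotents, but the
  coefficient at 2 is nonzero for even \<open>i\<close> and the one at 3 for odd
  \<open>i\<close>.\<close>

lemma rel_nonempty:
  assumes "i \<le> 4"
  shows "R i \<noteq> {}"
proof
  assume "R i = {}"
  then have "comb (adjacency_coeff i) = mtx_zero"
    using adjacency_eq_comb[OF assms] by (simp add: adjacency_def mtx_zero_def)
  then have "adjacency_coeff i 2 = 0" "adjacency_coeff i 3 = 0"
    by (auto simp: comb_eq_zero_iff)
  then show False
    using assms card_C_pos q_ge_2 degrees_less degree_ge_2
    by (auto simp: le_4_cases adjacency_coeff_def between_coeff_def within_coeff_def Let_def)
qed

sublocale idempotent_scheme X 4 E R
proof
  show "finite X" "X \<noteq> {}"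
    by (fact finite_X X_nonempty)+
  show "R i \<noteq> {}" if "i \<le> 4" for i
    using that by (rule rel_nonempty)
  show "R i \<subseteq> X \<times> X" for i
    by (auto simp: rel_iff)
  show "R 0 = Id_on X"
  proof (rule set_eqI)
    show "u \<in> R 0 \<longleftrightarrow> u \<in> Id_on X" for u
      using X_length
      by (cases u) (auto simp: rel_iff hamming_dist_eq_0_iff)
  qed
  show "\<exists>!i. i \<le> 4 \<and> (x, y) \<in> R i" if "x \<in> X" "y \<in> X" for x y
    using that by (rule rel_partition)
  show "sym (R i)" for i
    using X_length by (auto simp: sym_def rel_iff hamming_dist_commute)
  show "E j x y = 0" if "(x, y) \<notin> X \<times> X" for j x y
    using that by (auto simp: E_def)
  show "\<exists>v. \<forall>(x, y)\<in>R i. E j x y = v" if "i \<le> 4" "j \<le> 4" for i j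
  proof (intro exI ballI, clarify)
    fix x y
    assume xy: "(x, y) \<in> R i"
    then show "E j x y = zonal_value j (even i) ([0, \<alpha>1 - 1, \<alpha>1, \<alpha>2 - 1, \<alpha>2] ! i) / real (card C)"
      using that rel_lead[OF xy] by (auto simp: E_eq_value rel_iff)
  qed
  show "adjacency (R i) \<in> range comb" if "i \<le> 4" for i
    using adjacency_eq_comb[OF that] by simp
qed

section \<open>Krein parameters\<close>

definition krein_table :: "nat \<Rightarrow> nat \<Rightarrow> real" where
  "krein_table j k = (let r = real q - 1; b = (real n - 2) * r in
    if k \<le> 4 then
      [[0, 1, 0, 0, 0],
       [mult_1, r - 1, 2, 0, 0],
       [0, b, mult_1 - 2 * real q, b, 0],
       [0, 0, 2 * r, r - 1, mult_1],
       [0, 0, 0, 1, 0]] ! j ! k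
    else 0)"

text \<open>Each kernel is multiplied by the one with index 1 and expanded again. In row
  \<open>j\<close> and column \<open>k\<close> of the table, the dual intersection numbers
  \<open>krein_b\<close> stand just below the diagonal and \<open>krein_c\<close> just above
  it.\<close>

lemma krein_1:
  assumes "j \<le> 4"
  shows "krein X 4 E 1 j = krein_table j"
proof (rule krein_eqI)
  show "card X \<noteq> 0"
    using card_X card_C_pos by simp
  show "krein_table j k = 0" if "k > 4" for k
    using that by (simp add: krein_table_def)
  fix x y
  show "E 1 x y * E j x y = 1 / real (card X) * (\<Sum>k\<le>4. krein_table j k * E k x y)"
  proof (cases "x \<in> X \<and> y \<in> X")
    case False
    then show ?thesis
      by (auto simp: E_def)
  next
    case True
    define z where "z j = zonal_value j (lead x = lead y) (hamming_dist x y)" for j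
    define N where "N = real (card C)"
    have N: "N \<noteq> 0"
      using card_C_pos by (simp add: N_def)
    have E: "E k x y = z k / N" if "k \<le> 4" for k
      using True that by (simp add: E_eq_value z_def N_def)
    have z0: "z 0 = 1" and z3: "z 3 = z 4 * z 1"
      and sq: "(z 1)\<^sup>2 = 2 * z 2 + (real q - 2) * z 1 + mult_1"
      unfolding z_def by (fact zonal_value_simps zonal_value_2)+
    have W: "1 + z 1 + z 2 + z 4 * z 1 + z 4 = N * of_bool (x = y)"
      unfolding z_def N_def using sum_zonal_value True by blast
    \<comment> \<open>Off the diagonal the sum vanishes; on it \<open>z 1\<close> equals
      \<open>mult_1\<close>.\<close>
    have z1W: "z 1 * (1 + z 1 + z 2 + z 4 * z 1 + z 4) = mult_1 * (1 + z 1 + z 2 + z 4 * z 1 + z 4)"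
    proof (cases "x = y")
      case True
      then have "z 1 = mult_1"
        using hamming_dist_eq_0_iff[of x y] unfolding z_def zonal_value_simps by simp
      then show ?thesis
        by simp
    qed (simp add: W del: One_nat_def)
    \<comment> \<open>If the leading letters differ, \<open>z 4 = - 1\<close> cancels everything in
      \<open>W\<close> but \<open>z 2\<close>, which is therefore zero. Elsewhere
      \<open>z 4 = q - 1\<close>.\<close>
    have z42: "z 4 * z 2 = (real q - 1) * z 2"
    proof (cases "lead x = lead y")
      case True
      then show ?thesis
        unfolding z_def zonal_value_simps by simp
    next
      case False
      then have "z 4 = - 1" "x \<noteq> y"
        unfolding z_def zonal_value_simps by auto
      then have "z 2 = 0"
        using W by simp
      then show ?thesis
        by simp
    qed
    have mult_1: "mult_1 = (real n - 1) * (real q - 1)"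
      by (simp add: mult_1_def)
    have prod: "z 1 * z j = krein_table j 0 * z 0 + krein_table j 1 * z 1 + krein_table j 2 * z 2
        + krein_table j 3 * z 3 + krein_table j 4 * z 4"
    proof -
      have p1: "z 1 * z 1 = mult_1 + (real q - 1 - 1) * z 1 + 2 * z 2"
        using sq by algebra
      have p3: "z 1 * z 3 = 2 * (real q - 1) * z 2 + (real q - 1 - 1) * z 3 + mult_1 * z 4"
        using p1 z42 z3 by algebra
      \<comment> \<open>The product with \<open>z 2\<close> is solved from \<open>z1W\<close>, whose
        other products are known from \<open>p1\<close>, \<open>p3\<close> and
        \<open>z3\<close>.\<close>
      have p2: "z 1 * z 2 = (real n - 2) * (real q - 1) * z 1 + (mult_1 - 2 * real q) * z 2
          + (real n - 2) * (real q - 1) * z 3"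
        using p1 p3 z1W z3 mult_1 by algebra
      consider "j = 0" | "j = 1" | "j = 2" | "j = 3" | "j = 4"
        using assms by (auto simp: le_4_cases)
      then show ?thesis
      proof cases
        case 1
        then show ?thesis by (simp add: krein_table_def Let_def z0)
      next
        case 2
        then show ?thesis using p1 by (simp add: krein_table_def Let_def z0)
      next
        case 3
        then show ?thesis using p2 by (simp add: krein_table_def Let_def)
      next
        case 4
        then show ?thesis using p3 by (simp add: krein_table_def Let_def)
      next
        case 5
        then show ?thesis using z3 by (simp add: krein_table_def Let_def)
      qed
    qed
    have "E 1 x y * E j x y = z 1 * z j / N\<^sup>2"
      using assms by (simp add: E power2_eq_square)
    also have "\<dots> = 1 / N * (\<Sum>k\<le>4. krein_table j k * (z k / N))"
      unfolding prod sum_atMost_4 using N by (simp add: field_simps power2_eq_square)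
    also have "\<dots> = 1 / real (card X) * (\<Sum>k\<le>4. krein_table j k * E k x y)"
      by (simp add: E N_def card_X)
    finally show ?thesis .
  qed
qed

section \<open>The Q-polynomial and Q-antipodal properties\<close>

lemma E_0: "E 0 = (\<lambda>x y. mtx_all_ones X x y / real (card X))"
  by (auto simp: E_def mtx_all_ones_def card_X zonal_0[OF n_pos] fun_eq_iff)

lemma Q_polynomial: "Q_polynomial X 4 R E"
  unfolding Q_polynomial_def
proof (intro conjI allI impI)
  show "association_scheme X 4 R"
    by (rule association_scheme)
  show "idempotent_ordering X 4 R E"
    using E_0 by (rule idempotent_ordering)
  \<comment> \<open>These bounds make every entry of the table next to the diagonal nonzero.\<close>
  have pos: "mult_1 > 0" "real n > 2" "real q > 1"
    using n_ge_4 q_ge_2 by (auto simp: mult_1_def)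
  fix j k :: nat
  assume jk: "j \<le> 4" "k \<le> 4"
  show "krein X 4 E 1 j k = 0" if "k + 1 < j \<or> j + 1 < k"
    using jk that by (auto simp: krein_1 le_4_cases krein_table_def Let_def simp del: One_nat_def)
  show "krein X 4 E 1 j k \<noteq> 0" if "j = k + 1 \<or> k = j + 1"
    using jk that pos by (auto simp: krein_1 le_4_cases krein_table_def Let_def simp del: One_nat_def)
qed simp

lemma krein_array:
  "krein_array X 4 E =
    ([(real n - 1) * (real q - 1), (real n - 2) * (real q - 1), 2 * (real q - 1), 1],
     [1, 2, (real n - 2) * (real q - 1), (real n - 1) * (real q - 1)])"
proof -
  have "[0..<4] = [0, 1, 2, 3]" "[1..<4 + 1] = [1, 2, 3, 4 :: nat]"
    by (simp_all add: upt_rec)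
  then show ?thesis
    by (simp add: krein_array_def krein_b_def krein_c_def krein_1 krein_table_def Let_def mult_1_def
        del: One_nat_def)
qed

lemma Q_antipodal: "Q_antipodal X 4 R E"
  unfolding Q_antipodal_def
proof (intro conjI allI impI)
  show "Q_polynomial X 4 R E"
    by (rule Q_polynomial)
  fix i :: nat
  assume "i < 4" "i \<noteq> 4 div 2"
  then have "i = 0 \<or> i = 1 \<or> i = 3"
    by auto
  then show "krein_b X 4 E i = krein_c X 4 E (4 - i)"
    by (auto simp: krein_b_def krein_c_def krein_1 krein_table_def Let_def mult_1_def simp del: One_nat_def)
qed

end

theorem theorem3p2:
  fixes q n \<alpha>1 \<alpha>2 :: nat and C :: "nat list set"
  assumes "q \<ge> 2" and "n \<ge> 2"
    and "tight_4_design n q C"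
    and "degree_set C = {\<alpha>1, \<alpha>2}" and "\<alpha>1 < \<alpha>2"
  shows "association_scheme (tilde_code q C) 4 (tilde_rel q C \<alpha>1 \<alpha>2) \<and>
    (\<exists>E. Q_polynomial (tilde_code q C) 4 (tilde_rel q C \<alpha>1 \<alpha>2) E \<and>
         Q_antipodal (tilde_code q C) 4 (tilde_rel q C \<alpha>1 \<alpha>2) E \<and>
         krein_array (tilde_code q C) 4 E =
           ([(real n - 1) * (real q - 1), (real n - 2) * (real q - 1), 2 * (real q - 1), 1],
            [1, 2, (real n - 2) * (real q - 1), (real n - 1) * (real q - 1)]))"
proof -
  interpret tight_design n q \<alpha>1 \<alpha>2 C
    using assms by unfold_locales
  show ?thesis
    using association_scheme Q_polynomial Q_antipodal krein_array by blast
qed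

end
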